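(* Let $m$ and $N$ be even integers such that $0\le m\le N$. Let $\boldsymbol u=(u_1,\dots,u_m)$ be an $m$-vertex and $S=\{V_1<\cdots<V_N\}$ a totally ordered set of vertices in an acyclic digraph $D$. Let $A=(a_{V_iV_j})_{1\le i,j\le N}$ be a nonsingular skew-symmetric matrix with rows and columns indexed by $S$, and let $\widehat A$ denote its copfaffian matrix. Then $$\sum_{I\in\binom Sm}\operatorname{Pf}(A^I_I)\sum_{\pi\in S_m}\operatorname{sgn}(\pi)\,F^0(\boldsymbol u^\pi,I)=\operatorname{Pf}(A)\,\operatorname{Pf}\begin{pmatrix}O_m&H(\boldsymbol u,S)J_N\\-J_N\,{}^tH(\boldsymbol u,S)&\frac1{\operatorname{Pf}(A)}J_N\,{}^t\widehat A\,J_N\end{pmatrix}.$$ In particular, if $\boldsymbol u$ is $D$-compatible with $S$, then $$\sum_{I\in\binom Sm}\operatorname{Pf}(A^I_I)\,F^0(\boldsymbol u,I)=\operatorname{Pf}(A)\,\operatorname{Pf}\begin{pmatrix}O_m&H(\boldsymbol u,S)J_N\\-J_N\,{}^tH(\boldsymbol u,S)&\frac1{\operatorname{Pf}(A)}J_N\,{}^t\widehat A\,J_N\end{pmatrix}.$$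
   Context: $D=(V,E)$ is an acyclic digraph without multiple edges, with only finitely many directed paths between any two vertices. For vertices $u,v$, $\mathcal P(u,v)$ is the set of directed paths from $u$ to $v$. Each edge $e$ carries a commutative indeterminate $x_e$ as weight; the weight of a path is the product of the weights of its edges, and $h(u,v)=\sum_{P\in\mathcal P(u,v)}\operatorname{wt}(P)$. An $n$-vertex is an $n$-tuple of vertices. For $n$-vertices $\boldsymbol u,\boldsymbol v$, an $n$-path from $\boldsymbol u$ to $\boldsymbol v$ is $(P_1,\dots,P_n)$ with $P_i\in\mathcal P(u_i,v_i)$; its weight is the product of the weights of the $P_i$; it is non-intersecting if $P_i$ and $P_j$ share no vertex for all $i\ne j$. $F^0(\boldsymbol u,\boldsymbol v)$ is the sum of the weights of all non-intersecting $n$-paths from $\boldsymbol u$ to $\boldsymbol v$. For a permutation $\pi$, $\boldsymbol u^\pi=(u_{\pi(1)},\dots,u_{\pi(n)})$. A finite totally ordered set of vertices is regarded as the tuple of its elements in increasing order. A tuple $(u_1,\dots,u_m)$ is $D$-compatible with a tuple $(v_1,\dots,v_n)$ if every path in $\mathcal P(u_i,v_l)$ intersects (shares a vertex with) every path in $\mathcal P(u_j,v_k)$ whenever $i<j$ and $k<l$. $H(\boldsymbol u,S)=(h(u_i,V_j))_{1\le i\le m,1\le j\le N}$. $\binom Sm$ is the set of $m$-element subsets of $S$; $S_m$ is the symmetric group. $A^I_I$ is the submatrix of $A$ with rows and columns indexed by $I$. $\operatorname{Pf}$ is the Pfaffian of a skew-symmetric matrix of even size, normalized by $\operatorname{Pf}\begin{pmatrix}0&a\\-a&0\end{pmatrix}=a$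 (empty Pfaffian $=1$). The copfaffian matrix $\widehat A$ of a skew-symmetric $A$ of even size $N$ is the skew-symmetric matrix with $(i,j)$ entry, for $i<j$, equal to $(-1)^{i+j-1}$ times the Pfaffian of $A$ with rows and columns $i,j$ removed. $J_N$ is the $N\times N$ matrix with ones on the antidiagonal and zeros elsewhere, $O_m$ the $m\times m$ zero matrix, ${}^tX$ the transpose. *)

theory Defs
  imports
    "Graph_Theory.Arc_Walk"
    "Jordan_Normal_Form.Determinant"
    "Jordan_Normal_Form.DL_Submatrix"
    "HOL-Combinatorics.Permutations"
begin

section \<open>Path systems in acyclic digraphs\<close>

text \<open>
  Tuples of vertices are lists. A finite totally ordered set \<open>V\<^sub>1 < \<dots> < V\<^sub>N\<close> of vertices is
  given by the distinct list of its elements in increasing order. List and matrix indices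
  start at 0.

  The edge weights are an arbitrary function \<open>x\<close> from the arcs into a commutative ring or field;
  indeterminate weights are the special case in which the field is one of rational functions in
  the indeterminates \<open>x e\<close>.
\<close>

definition paths :: "('v, 'e) pre_digraph \<Rightarrow> 'v \<Rightarrow> 'v \<Rightarrow> 'e list set" where
  "paths D u v = {p. pre_digraph.apath D u p v}"

locale acyclic_path_finite_digraph = nomulti_digraph D for D :: "('v, 'e) pre_digraph" +
  assumes acyclic: "\<nexists>p. cycle p"
    and finite_paths: "\<And>u v. u \<in> verts D \<Longrightarrow> v \<in> verts D \<Longrightarrow> finite (paths D u v)"

definition path_weight :: "('e \<Rightarrow> 'k::comm_ring_1) \<Rightarrow> 'e list \<Rightarrow> 'k" where
  "path_weight x p = (\<Prod>e\<leftarrow>p. x e)"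

definition path_sum :: "('v, 'e) pre_digraph \<Rightarrow> ('e \<Rightarrow> 'k::comm_ring_1) \<Rightarrow> 'v \<Rightarrow> 'v \<Rightarrow> 'k" where
  "path_sum D x u v = (\<Sum>p\<in>paths D u v. path_weight x p)"

text \<open>
  An arc list determines its vertices only together with its start vertex, since the empty list
  is a path from every vertex to itself.
\<close>

definition path_verts :: "('v, 'e) pre_digraph \<Rightarrow> 'v \<Rightarrow> 'e list \<Rightarrow> 'v set" where
  "path_verts D u p = set (pre_digraph.awalk_verts D u p)"

definition n_paths :: "('v, 'e) pre_digraph \<Rightarrow> 'v list \<Rightarrow> 'v list \<Rightarrow> 'e list list set" where
  "n_paths D u v = {P. length P = length u \<and> length u = length v \<and>
     (\<forall>i<length u. P ! i \<in> paths D (u ! i) (v ! i))}"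

definition non_intersecting :: "('v, 'e) pre_digraph \<Rightarrow> 'v list \<Rightarrow> 'e list list \<Rightarrow> bool" where
  "non_intersecting D u P \<longleftrightarrow> (\<forall>i<length P. \<forall>j<length P. i \<noteq> j \<longrightarrow>
     path_verts D (u ! i) (P ! i) \<inter> path_verts D (u ! j) (P ! j) = {})"

definition F0 ::
  "('v, 'e) pre_digraph \<Rightarrow> ('e \<Rightarrow> 'k::comm_ring_1) \<Rightarrow> 'v list \<Rightarrow> 'v list \<Rightarrow> 'k" where
  "F0 D x u v = (\<Sum>P\<in>{P \<in> n_paths D u v. non_intersecting D u P}. \<Prod>p\<leftarrow>P. path_weight x p)"

definition D_compatible :: "('v, 'e) pre_digraph \<Rightarrow> 'v list \<Rightarrow> 'v list \<Rightarrow> bool" where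
  "D_compatible D u v \<longleftrightarrow>
     (\<forall>i j k l. i < j \<and> j < length u \<and> k < l \<and> l < length v \<longrightarrow>
       (\<forall>P\<in>paths D (u ! i) (v ! l). \<forall>Q\<in>paths D (u ! j) (v ! k).
         path_verts D (u ! i) P \<inter> path_verts D (u ! j) Q \<noteq> {}))"

definition H_mat ::
  "('v, 'e) pre_digraph \<Rightarrow> ('e \<Rightarrow> 'k::comm_ring_1) \<Rightarrow> 'v list \<Rightarrow> 'v list \<Rightarrow> 'k mat" where
  "H_mat D x u S = mat (length u) (length S) (\<lambda>(i, j). path_sum D x (u ! i) (S ! j))"

definition subset_tuple :: "'v list \<Rightarrow> 'v set \<Rightarrow> 'v list" where
  "subset_tuple S I = filter (\<lambda>v. v \<in> I) S"

section \<open>Pfaffians\<close>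

text \<open>
  The diagonal is required to vanish explicitly, which matters only in characteristic 2.
\<close>

definition skew_symmetric :: "'k::comm_ring_1 mat \<Rightarrow> bool" where
  "skew_symmetric A \<longleftrightarrow> square_mat A \<and> transpose_mat A = - A \<and> (\<forall>i<dim_row A. A $$ (i, i) = 0)"

text \<open>
  A perfect matching \<open>{{\<sigma> 0, \<sigma> 1}, {\<sigma> 2, \<sigma> 3}, \<dots>}\<close> of \<open>{0, \<dots>, n - 1}\<close>, \<open>n\<close> even, is represented
  by the unique permutation with \<open>\<sigma> (2 * i) < \<sigma> (2 * i + 1)\<close> and \<open>\<sigma> 0 < \<sigma> 2 < \<sigma> 4 < \<dots>\<close>.
\<close>

definition matchings :: "nat \<Rightarrow> (nat \<Rightarrow> nat) set" where
  "matchings n = {\<sigma>. \<sigma> permutes {..<n} \<and>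
     (\<forall>i < n div 2. \<sigma> (2 * i) < \<sigma> (2 * i + 1)) \<and>
     (\<forall>i j. i < j \<and> j < n div 2 \<longrightarrow> \<sigma> (2 * i) < \<sigma> (2 * j))}"

text \<open>Only meaningful for skew-symmetric matrices of even size.\<close>

definition Pf :: "'k::comm_ring_1 mat \<Rightarrow> 'k" where
  "Pf A = (\<Sum>\<sigma>\<in>matchings (dim_row A).
     of_int (sign \<sigma>) * (\<Prod>i<dim_row A div 2. A $$ (\<sigma> (2 * i), \<sigma> (2 * i + 1))))"

text \<open>
  With indices starting at 0, the sign \<open>(-1)\<^bsup>i+j-1\<^esup>\<close> for indices starting at 1 becomes
  \<open>(-1)\<^bsup>i+j+1\<^esup>\<close>.
\<close>

definition copfaffian_mat :: "'k::comm_ring_1 mat \<Rightarrow> 'k mat" where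
  "copfaffian_mat A = (let N = dim_row A;
       c = (\<lambda>i j. (-1) ^ (i + j + 1) * Pf (submatrix A ({..<N} - {i, j}) ({..<N} - {i, j})))
     in mat N N (\<lambda>(i, j). if i < j then c i j else if j < i then - c j i else 0))"

definition principal_submat :: "'k mat \<Rightarrow> 'v list \<Rightarrow> 'v set \<Rightarrow> 'k mat" where
  "principal_submat A S I =
     (let K = {i. i < length S \<and> S ! i \<in> I} in submatrix A K K)"

definition J_mat :: "nat \<Rightarrow> 'k::comm_ring_1 mat" where
  "J_mat N = mat N N (\<lambda>(i, j). if i + j + 1 = N then 1 else 0)"

end

theory Submission
  imports Defs
begin

text \<open>
  Both sides are equal to \<open>Pf (H A H\<^sup>T)\<close>, where \<open>H = H(u, S)\<close>. On the left, the
  Lindstroem-Gessel-Viennot lemma turns the inner sum into a maximal minor of \<open>H\<close>, and the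
  minor summation formula \<open>Pf (B A B\<^sup>T) = \<Sum>\<^sub>K Pf (A\<^sub>K) det (B\<^sub>K)\<close> sums these minors. On the right,
  the copfaffian expansion identifies the lower right block with \<open>J A\<^sup>-\<^sup>1 J\<close>, and the
  congruence by a unitriangular matrix clears the off-diagonal blocks, leaving
  \<open>Pf (H A H\<^sup>T) Pf (J A\<^sup>-\<^sup>1 J)\<close>. The remaining factor satisfies \<open>Pf A \<sqdot> Pf (J A\<^sup>-\<^sup>1 J) = 1\<close>: this is the
  case \<open>H = 1\<close>, in which the block Pfaffian is \<open>1\<close> by expansion along its rows.

  The Pfaffian is handled through its recursive expansion along the first row, for a matrix whose
  rows and columns are indexed by an arbitrary list. This makes it an alternating function of the
  list, in every characteristic.
\<close>

section \<open>The Pfaffian of a list of indices\<close>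

text \<open>Characteristic 2 shapes many statements: a change of sign under exchange does not force
  a value to vanish there, so repeated indices, zero diagonals and the cancellation of intersecting
  path systems each receive an argument that never divides by 2. The formula divides by
  \<open>Pf A\<close>, while the hypothesis is that \<open>A\<close> is invertible. The usual
  bridge, that the determinant is the square of the Pfaffian, is bypassed: congruence is the case of
  the minor summation formula with a single subset, and the Schur complement for
  \<open>H = 1\<close> then gives an explicit inverse of \<open>Pf A\<close>. The antidiagonal
  matrices remove a sign. With an identity matrix in the corner, the pairs \<open>i\<close>,
  \<open>N + i\<close> would all cross and contribute \<open>(-1) ^ (N * (N - 1) div 2)\<close>;
  reversing the columns makes the pairs nested, with sign 1.\<close>

definition drop_nth :: "nat \<Rightarrow> 'a list \<Rightarrow> 'a list" where
  "drop_nth j xs = take j xs @ drop (Suc j) xs"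

lemma length_drop_nth: "j < length xs \<Longrightarrow> length (drop_nth j xs) = length xs - 1"
  by (simp add: drop_nth_def min_def)

lemma length_drop_nth_le [termination_simp]: "length (drop_nth j xs) < Suc (length xs)"
  by (auto simp: drop_nth_def min_def)

lemma nth_drop_nth: "i < length xs - 1 \<Longrightarrow> j < length xs \<Longrightarrow> drop_nth j xs ! i = (if i < j then xs ! i else xs ! Suc i)"
  by (auto simp: drop_nth_def nth_append min_def)

lemma drop_nth_0 [simp]: "drop_nth 0 (x # xs) = xs"
  by (simp add: drop_nth_def)

lemma drop_nth_Suc [simp]: "drop_nth (Suc j) (x # xs) = x # drop_nth j xs"
  by (simp add: drop_nth_def)

lemma drop_nth_append1: "j < length xs \<Longrightarrow> drop_nth j (xs @ ys) = drop_nth j xs @ ys"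
  by (simp add: drop_nth_def)

lemma drop_nth_append2: "drop_nth (length xs + j) (xs @ ys) = xs @ drop_nth j ys"
  by (simp add: drop_nth_def)

lemma map_drop_nth: "map f (drop_nth j xs) = drop_nth j (map f xs)"
  by (simp add: drop_nth_def take_map drop_map)

lemma set_drop_nth_subset: "set (drop_nth j xs) \<subseteq> set xs"
  by (auto simp: drop_nth_def dest: in_set_takeD in_set_dropD)

text \<open>Addressing the entries through a list turns deletion, reordering and repetition of
  indices into list operations, and every minor is again of the form \<open>pf_list a ys\<close>. On
  lists of odd length the recursion ends in an empty sum, so the value is 0.\<close>

fun pf_list :: "('a \<Rightarrow> 'a \<Rightarrow> 'k::comm_ring_1) \<Rightarrow> 'a list \<Rightarrow> 'k" where
  "pf_list a [] = 1"
| "pf_list a (x # xs) = (\<Sum>j<length xs. (-1) ^ j * a x (xs ! j) * pf_list a (drop_nth j xs))"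

declare pf_list.simps(2) [simp del]

lemma pf_list_map: "pf_list a (map f xs) = pf_list (\<lambda>i j. a (f i) (f j)) xs"
proof (induction xs rule: length_induct)
  case (1 xs)
  show ?case
  proof (cases xs)
    case (Cons y ys)
    have "pf_list a (drop_nth j (map f ys)) = pf_list (\<lambda>i j. a (f i) (f j)) (drop_nth j ys)" for j
      using 1 length_drop_nth_le[of j ys] by (simp add: Cons flip: map_drop_nth)
    then show ?thesis
      by (simp add: Cons pf_list.simps)
  qed simp
qed

lemma pf_list_cong:
  assumes "\<And>i j. i \<in> set xs \<Longrightarrow> j \<in> set xs \<Longrightarrow> a i j = b i j"
  shows "pf_list a xs = pf_list b xs"
  using assms
proof (induction xs rule: length_induct)
  case (1 xs)
  show ?case
  proof (cases xs)
    case (Cons y ys)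
    have "pf_list a (drop_nth j ys) = pf_list b (drop_nth j ys)" for j
      using 1(1)[rule_format, of "drop_nth j ys"] 1(2) length_drop_nth_le[of j ys] set_drop_nth_subset[of j ys]
      by (simp add: Cons subset_iff)
    then show ?thesis
      using 1(2) by (auto simp: Cons pf_list.simps intro!: sum.cong)
  qed simp
qed

section \<open>Alternation of the list Pfaffian in its indices\<close>

definition alternating :: "('a \<Rightarrow> 'a \<Rightarrow> 'k::comm_ring_1) \<Rightarrow> bool" where
  "alternating a \<longleftrightarrow> (\<forall>i. a i i = 0) \<and> (\<forall>i j. a i j = - a j i)"

lemma drop_nth_drop_nth_swap:
  assumes "k < j" "j < length zs"
  shows "drop_nth (j - 1) (drop_nth k zs) = drop_nth k (drop_nth j zs)"
proof (rule nth_equalityI)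
  show "length (drop_nth (j - 1) (drop_nth k zs)) = length (drop_nth k (drop_nth j zs))"
    using assms by (simp add: length_drop_nth)
  fix i assume "i < length (drop_nth (j - 1) (drop_nth k zs))"
  then have i: "i < length zs - 2"
    using assms by (simp add: length_drop_nth)
  show "drop_nth (j - 1) (drop_nth k zs) ! i = drop_nth k (drop_nth j zs) ! i"
    using i assms by (simp add: length_drop_nth nth_drop_nth) linarith
qed

text \<open>Expansion along the first two rows: \<open>x\<close> and \<open>y\<close> are matched
  with each other or with two entries of \<open>zs\<close>, and the two ways of doing the latter
  combine into a 2 by 2 minor. In this form the effect of exchanging \<open>x\<close> and
  \<open>y\<close>, or of making them equal, can be read off.\<close>

lemma pf_list_two:
  "pf_list a (x # y # zs) = a x y * pf_list a zs +
     (\<Sum>(j,k)\<in>{(j,k). k < j \<and> j < length zs}. (-1) ^ (j + k + 1) *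
        (a x (zs ! j) * a y (zs ! k) - a y (zs ! j) * a x (zs ! k)) * pf_list a (drop_nth k (drop_nth j zs)))"
proof -
  define n where "n = length zs"
  \<comment> \<open>The term in which \<open>x\<close> is matched with \<open>zs ! j\<close> and
    \<open>y\<close> with position \<open>k\<close> of what is left. The extra 1 in the exponent
    accounts for \<open>y\<close>, which stands before \<open>zs\<close>.\<close>
  define t where "t = (\<lambda>x y (j,k). (-1) ^ (j + k + 1) * (a x (zs ! j) * a y (drop_nth j zs ! k)) * pf_list a (drop_nth k (drop_nth j zs)))"
  let ?L = "{(j,k). k < j \<and> j < n}" and ?R = "{(j,k). j \<le> k \<and> k < n - 1}"
  have LR: "{..<n} \<times> {..<n - 1} = ?L \<union> ?R" by auto
  have fin: "finite ?L" "finite ?R"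
    by (rule finite_subset[of _ "{..<n} \<times> {..<n}"]; auto)+
  have inner: "(-1) ^ Suc j * a x (zs ! j) * pf_list a (y # drop_nth j zs) = (\<Sum>k<n-1. t x y (j,k))" if "j < n" for j
  proof -
    have "length (drop_nth j zs) = n - 1"
      using that by (simp add: length_drop_nth n_def)
    then show ?thesis
      by (simp add: pf_list.simps(2)[of a y] sum_distrib_left t_def power_add mult.assoc mult.left_commute)
  qed
  have "pf_list a (x # y # zs) = a x y * pf_list a zs + (\<Sum>j<n. (-1) ^ Suc j * a x (zs ! j) * pf_list a (y # drop_nth j zs))"
    unfolding pf_list.simps(2)[of a x] list.size(4) add_Suc_right add_0_right sum.lessThan_Suc_shift
    by (simp add: n_def)
  also have "(\<Sum>j<n. (-1) ^ Suc j * a x (zs ! j) * pf_list a (y # drop_nth j zs)) = (\<Sum>j<n. \<Sum>k<n-1. t x y (j,k))"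
    using inner by (intro sum.cong) auto
  also have "(\<Sum>j<n. \<Sum>k<n-1. t x y (j,k)) = (\<Sum>p\<in>?L. t x y p) + (\<Sum>p\<in>?R. t x y p)"
    unfolding sum.cartesian_product LR using fin by (subst sum.union_disjoint) auto
  \<comment> \<open>For \<open>j \<le> k\<close>, position \<open>k\<close> after the deletion of
    \<open>j\<close> is position \<open>Suc k\<close> of \<open>zs\<close>. Passing to the pair
    \<open>(Suc k, j)\<close> exchanges the roles of \<open>x\<close> and \<open>y\<close>, and the
    added \<open>Suc\<close> in the exponent yields the minus sign.\<close>
  also have "(\<Sum>p\<in>?R. t x y p) = (\<Sum>p\<in>?L. - t y x p)"
  proof (rule sum.reindex_bij_witness[of _ "\<lambda>(j,k). (k, j - 1)" "\<lambda>(j,k). (k + 1, j)"])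
    fix p assume "p \<in> ?R"
    then obtain j k where p: "p = (j,k)" "j \<le> k" "Suc k < n" by auto
    have 1: "drop_nth j zs ! k = zs ! Suc k" "drop_nth (Suc k) zs ! j = zs ! j"
      using p by (auto simp: nth_drop_nth n_def)
    have 2: "drop_nth k (drop_nth j zs) = drop_nth j (drop_nth (Suc k) zs)"
      using drop_nth_drop_nth_swap[of j "Suc k" zs] p by (simp add: n_def)
    show "- t y x (case p of (j, k) \<Rightarrow> (k + 1, j)) = t x y p"
      by (simp add: p(1) t_def 1 2 algebra_simps)
  qed auto
  also have "(\<Sum>p\<in>?L. t x y p) + (\<Sum>p\<in>?L. - t y x p) = (\<Sum>(j,k)\<in>?L. (-1) ^ (j + k + 1) *
        (a x (zs ! j) * a y (zs ! k) - a y (zs ! j) * a x (zs ! k)) * pf_list a (drop_nth k (drop_nth j zs)))"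
    unfolding sum.distrib[symmetric]
    by (rule sum.cong) (auto simp: t_def nth_drop_nth n_def algebra_simps)
  finally show ?thesis unfolding n_def .
qed

text \<open>Induction on the number of other entries. At the front of the list the expansion along
  two rows settles the claim; elsewhere the first row \<open>p\<close> is expanded and the pair
  survives in all but two of the smaller Pfaffians.\<close>

lemma pf_list_swap_adjacent:
  assumes "alternating a"
  shows "pf_list a (ps @ y # x # qs) = - pf_list a (ps @ x # y # qs)"
proof (induction "length (ps @ qs)" arbitrary: ps qs rule: less_induct)
  case less
  have alt: "a j i = - a i j" for i j using assms unfolding alternating_def by metis
  show ?case
  proof (cases ps)
    case Nil
    show ?thesis
      unfolding Nil append_Nil pf_list_two minus_add_distrib sum_negf[symmetric]
      by (intro arg_cong2[of _ _ _ _ "(+)"] sum.cong) (auto simp: algebra_simps alt[of x y])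
  next
    case (Cons p ps')
    define k where "k = length ps'"
    define n where "n = length qs"
    define f where "f = (\<lambda>x y j. (-1) ^ j * a p ((ps' @ x # y # qs) ! j) * pf_list a (drop_nth j (ps' @ x # y # qs)))"
    \<comment> \<open>The pair occupies positions \<open>k\<close> and \<open>Suc k\<close> after
      \<open>p\<close>. Reindexing by this transposition aligns the terms that delete the same one
      of \<open>x\<close> and \<open>y\<close>: the remaining lists agree and the signs
      \<open>(-1) ^ j\<close> are opposite.\<close>
    let ?t = "transpose k (Suc k)"
    have pf: "pf_list a (ps @ x # y # qs) = sum (f x y) {..<k + n + 2}" for x y
      by (simp add: Cons pf_list.simps(2) f_def k_def n_def)
    have perm: "?t permutes {..<k + n + 2}"
      by (rule permutes_swap_id) auto
    have "sum (f y x) {..<k + n + 2} = sum (f y x \<circ> ?t) {..<k + n + 2}"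
      by (rule sum.permute[OF perm])
    also have "\<dots> = (\<Sum>j<k + n + 2. - f x y j)"
    proof (rule sum.cong[OF refl])
      fix j assume j: "j \<in> {..<k + n + 2}"
      consider "j < k" | "j = k" | "j = Suc k" | i where "j = length ps' + Suc (Suc i)" "i < n"
      proof -
        assume *: "j < k \<Longrightarrow> thesis" "j = k \<Longrightarrow> thesis" "j = Suc k \<Longrightarrow> thesis" "\<And>i. j = length ps' + Suc (Suc i) \<Longrightarrow> i < n \<Longrightarrow> thesis"
        show thesis
          using *(1-3) *(4)[of "j - k - 2"] j by (force simp: k_def)
      qed
      then show "(f y x \<circ> ?t) j = - f x y j"
      proof cases
        case 1
        have "pf_list a (drop_nth j ps' @ y # x # qs) = - pf_list a (drop_nth j ps' @ x # y # qs)"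
          by (rule less) (use 1 in \<open>simp add: Cons length_drop_nth k_def\<close>)
        then show ?thesis
          using 1 by (simp add: f_def drop_nth_append1 k_def nth_append)
      next
        case 2
        then show ?thesis
          using drop_nth_append2[of ps' 0 "x # y # qs"] drop_nth_append2[of ps' 1 "y # x # qs"]
          by (simp add: f_def nth_append k_def)
      next
        case 3
        then show ?thesis
          using drop_nth_append2[of ps' 1 "x # y # qs"] drop_nth_append2[of ps' 0 "y # x # qs"]
          by (simp add: f_def nth_append k_def)
      next
        case 4
        have "pf_list a (ps' @ y # x # drop_nth i qs) = - pf_list a (ps' @ x # y # drop_nth i qs)"
          by (rule less) (use 4 in \<open>simp add: Cons length_drop_nth n_def\<close>)
        then show ?thesis
          using 4(2) drop_nth_append2[of ps' "Suc (Suc i)"]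
            nth_append_length_plus[of ps' _ "Suc (Suc i)"]
          unfolding 4(1) by (simp add: f_def k_def)
      qed
    qed
    finally show ?thesis
      by (simp add: pf sum_negf)
  qed
qed

text \<open>Exchanging the two copies of \<open>x\<close> shows only that twice the value is 0,
  which says nothing in characteristic 2. Hence a separate induction, parallel to the one for the
  change of sign.\<close>

lemma pf_list_adjacent_eq:
  assumes "alternating a"
  shows "pf_list a (ps @ x # x # qs) = 0"
proof (induction "length (ps @ qs)" arbitrary: ps qs rule: less_induct)
  case less
  show ?case
  proof (cases ps)
    case Nil
    moreover have "a x x = 0"
      using assms unfolding alternating_def by blast
    ultimately show ?thesis
      by (simp add: pf_list_two)
  next
    case (Cons p ps')
    define k where "k = length ps'"
    define n where "n = length qs"
    define f where "f = (\<lambda>j. (-1) ^ j * a p ((ps' @ x # x # qs) ! j) * pf_list a (drop_nth j (ps' @ x # x # qs)))"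
    have "pf_list a (ps @ x # x # qs) = sum f {..<k + n + 2}"
      by (simp add: Cons pf_list.simps(2) f_def k_def n_def)
    \<comment> \<open>All other terms keep both copies of \<open>x\<close> and vanish by induction.
      The two that remain each delete one copy, leave the same list and have opposite signs.\<close>
    also have "\<dots> = sum f {k, Suc k}"
    proof (rule sum.mono_neutral_right)
      show "\<forall>j\<in>{..<k + n + 2} - {k, Suc k}. f j = 0"
      proof
        fix j assume j: "j \<in> {..<k + n + 2} - {k, Suc k}"
        consider "j < k" | i where "j = length ps' + Suc (Suc i)" "i < n"
        proof -
          assume *: "j < k \<Longrightarrow> thesis" "\<And>i. j = length ps' + Suc (Suc i) \<Longrightarrow> i < n \<Longrightarrow> thesis"
          show thesis
            using *(1) *(2)[of "j - k - 2"] j by (force simp: k_def)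
        qed
        then show "f j = 0"
        proof cases
          case 1
          have "pf_list a (drop_nth j ps' @ x # x # qs) = 0"
            by (rule less) (use 1 in \<open>simp add: Cons length_drop_nth k_def\<close>)
          then show ?thesis
            using 1 by (simp add: f_def drop_nth_append1 k_def)
        next
          case 2
          have "pf_list a (ps' @ x # x # drop_nth i qs) = 0"
            by (rule less) (use 2 in \<open>simp add: Cons length_drop_nth n_def\<close>)
          then show ?thesis
            using drop_nth_append2[of ps' "Suc (Suc i)"] unfolding 2(1) by (simp add: f_def)
        qed
      qed
    qed auto
    also have "\<dots> = 0"
      using drop_nth_append2[of ps' 0 "x # x # qs"] drop_nth_append2[of ps' 1 "x # x # qs"]
      by (simp add: f_def nth_append k_def)
    finally show ?thesis .
  qed
qed

lemma permute_list_transpose_Suc: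
  assumes "Suc j < length xs"
  obtains ps x y qs where "xs = ps @ x # y # qs" "permute_list (transpose j (Suc j)) xs = ps @ y # x # qs"
    "length ps = j"
proof
  show "xs = take j xs @ xs ! j # xs ! Suc j # drop (Suc (Suc j)) xs"
    using assms by (metis Cons_nth_drop_Suc Suc_lessD append_take_drop_id)
  show "permute_list (transpose j (Suc j)) xs = take j xs @ xs ! Suc j # xs ! j # drop (Suc (Suc j)) xs"
  proof (rule nth_equalityI)
    fix i assume "i < length (permute_list (transpose j (Suc j)) xs)"
    then have i: "i < length xs" by simp
    have perm: "transpose j (Suc j) permutes {..<length xs}"
      using assms by (intro permutes_swap_id) auto
    show "permute_list (transpose j (Suc j)) xs ! i = (take j xs @ xs ! Suc j # xs ! j # drop (Suc (Suc j)) xs) ! i"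
      using assms i unfolding permute_list_nth[OF perm i]
      by (auto simp: nth_append transpose_def nth_Cons intro!: arg_cong[of _ _ "nth xs"] split: nat.split)
  qed (use assms in auto)
  show "length (take j xs) = j" using assms by simp
qed

lemma transpose_Suc_conj:
  assumes "i < j"
  shows "transpose i (Suc j) = transpose j (Suc j) \<circ> transpose i j \<circ> transpose j (Suc j)"
  using assms by (auto simp: fun_eq_iff transpose_def)

text \<open>Induction on \<open>j\<close>: the transposition of \<open>i\<close> and
  \<open>Suc j\<close> is that of \<open>i\<close> and \<open>j\<close> conjugated by an adjacent
  one, and the two additional signs cancel.\<close>

lemma pf_list_transpose:
  assumes "alternating a" "i < j" "j < length xs"
  shows "pf_list a (permute_list (transpose i j) xs) = - pf_list a xs"
  using assms(2,3)
proof (induction j arbitrary: xs)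
  case (Suc j)
  have adj: "pf_list a (permute_list (transpose j (Suc j)) xs) = - pf_list a xs" if l: "Suc j < length xs" for j :: nat and xs
  proof -
    obtain ps x y qs where "xs = ps @ x # y # qs" "permute_list (transpose j (Suc j)) xs = ps @ y # x # qs" "length ps = j"
      using permute_list_transpose_Suc[OF l] by blast
    then show ?thesis
      using pf_list_swap_adjacent[OF assms(1), of ps y x qs] by simp
  qed
  show ?case
  proof (cases "i = j")
    case False
    have perm: "transpose j (Suc j) permutes {..<length xs}" "transpose i j permutes {..<length xs}"
      using Suc.prems by (auto intro!: permutes_swap_id)
    have "i < j" using False Suc.prems by simp
    show ?thesis
      unfolding transpose_Suc_conj[OF \<open>i < j\<close>] permute_list_compose[OF perm(1)]
      using \<open>i < j\<close> Suc.prems perm by (simp add: permute_list_compose adj Suc.IH)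
  qed (use adj Suc in auto)
qed simp

lemma pf_list_permute_list:
  assumes "alternating a" "p permutes {..<length xs}"
  shows "pf_list a (permute_list p xs) = of_int (sign p) * pf_list a xs"
proof -
  have "finite {..<length xs}" by simp
  from this assms(2) show ?thesis
  proof (induction rule: permutes_rev_induct)
    case (swap i j p)
    have perm: "transpose i j permutes {..<length xs}"
      using swap.hyps by (intro permutes_swap_id) auto
    have "sign (p \<circ> transpose i j) = - sign p"
      using swap.hyps permutes_imp_permutation[OF _ swap.hyps(4)]
      by (simp add: sign_compose permutation_swap_id sign_swap_id)
    moreover have "pf_list a (permute_list (transpose i j) ys) = - pf_list a ys" if "length ys = length xs" for ys
      using pf_list_transpose[OF assms(1), of i j ys] pf_list_transpose[OF assms(1), of j i ys] swap.hyps that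
      by (cases i j rule: linorder_cases) (auto simp: transpose_commute)
    ultimately show ?case
      unfolding permute_list_compose[OF perm] by (simp add: swap.IH del: o_apply)
  qed simp
qed

lemma pf_list_not_distinct:
  assumes "alternating a" "\<not> distinct xs"
  shows "pf_list a xs = 0"
proof -
  obtain i j where ij: "i < j" "j < length xs" "xs ! i = xs ! j"
    using assms(2) unfolding distinct_conv_nth by (metis nat_neq_iff)
  \<comment> \<open>This moves the second copy next to the first; for \<open>j = Suc i\<close> it is
    the identity.\<close>
  define p where "p = transpose (Suc i) j"
  have perm: "p permutes {..<length xs}"
    unfolding p_def using ij by (intro permutes_swap_id) auto
  define ys where "ys = permute_list p xs"
  have "ys ! i = xs ! i" "ys ! Suc i = xs ! i" and l: "Suc i < length ys"
    unfolding ys_def using ij perm by (auto simp: permute_list_nth p_def transpose_def)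
  then have "ys = take i ys @ xs ! i # xs ! i # drop (Suc (Suc i)) ys"
    using l by (metis Cons_nth_drop_Suc Suc_lessD append_take_drop_id)
  then have "pf_list a ys = 0"
    using pf_list_adjacent_eq[OF assms(1)] by metis
  then have "of_int (sign p) * pf_list a xs = 0"
    unfolding ys_def using pf_list_permute_list[OF assms(1) perm] by simp
  moreover have "sign p = 1 \<or> sign p = - 1"
    by (simp add: sign_def)
  ultimately show ?thesis by auto
qed

lemma pf_list_move_to_front:
  assumes "alternating a"
  shows "pf_list a (x # ps @ qs) = (-1) ^ length ps * pf_list a (ps @ x # qs)"
proof (induction ps arbitrary: qs rule: rev_induct)
  case (snoc y ps)
  then show ?case
    using pf_list_swap_adjacent[OF assms, of ps x y qs] by simp
qed simp

text \<open>Expansion along a row from \<open>xs\<close> finds only zeros in the columns from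
  \<open>ys\<close>, so \<open>ys\<close> is carried unchanged through the recursion on
  \<open>xs\<close>.\<close>

lemma pf_list_append_block:
  assumes "\<And>x y. x \<in> set xs \<Longrightarrow> y \<in> set ys \<Longrightarrow> a x y = 0"
  shows "pf_list a (xs @ ys) = pf_list a xs * pf_list a ys"
  using assms
proof (induction xs rule: length_induct)
  case (1 xs)
  show ?case
  proof (cases xs)
    case (Cons z zs)
    define f where "f = (\<lambda>j. (-1) ^ j * a z ((zs @ ys) ! j) * pf_list a (drop_nth j (zs @ ys)))"
    have eq1: "pf_list a (xs @ ys) = sum f {..<length zs + length ys}"
      by (simp add: Cons pf_list.simps(2) f_def)
    have eq2: "sum f {..<length zs + length ys} = sum f {..<length zs}"
    proof (rule sum.mono_neutral_right)
      show "\<forall>j\<in>{..<length zs + length ys} - {..<length zs}. f j = 0"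
        using 1(2) Cons by (auto simp: f_def nth_append)
    qed auto
    have eq3: "sum f {..<length zs} = (\<Sum>j<length zs. (-1) ^ j * a z (zs ! j) * pf_list a (drop_nth j zs) * pf_list a ys)"
    proof (rule sum.cong[OF refl])
      fix j assume j: "j \<in> {..<length zs}"
      have "pf_list a (drop_nth j zs @ ys) = pf_list a (drop_nth j zs) * pf_list a ys"
        using 1(1)[rule_format, of "drop_nth j zs"] 1(2) length_drop_nth_le[of j zs] set_drop_nth_subset[of j zs]
        by (simp add: Cons subset_iff)
      moreover have "drop_nth j (zs @ ys) = drop_nth j zs @ ys" "(zs @ ys) ! j = zs ! j"
        using j by (simp_all add: drop_nth_append1 nth_append)
      ultimately show "f j = (-1) ^ j * a z (zs ! j) * pf_list a (drop_nth j zs) * pf_list a ys"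
        by (simp only: f_def mult.assoc)
    qed
    show ?thesis
      unfolding eq1 eq2 eq3 by (simp only: Cons pf_list.simps(2) sum_distrib_right)
  qed simp
qed

section \<open>Matchings and the expansion along the first row\<close>

text \<open>The increasing enumeration of the positive numbers other than \<open>Suc j\<close>, that
  is, of the indices left once 0 has been matched with \<open>Suc j\<close>.\<close>

definition skip_idx :: "nat \<Rightarrow> nat \<Rightarrow> nat" where
  "skip_idx j i = (if i < j then Suc i else Suc (Suc i))"

lemma skip_idx_less_iff [simp]: "skip_idx j i < skip_idx j i' \<longleftrightarrow> i < i'"
  by (auto simp: skip_idx_def)

lemma skip_idx_pos [simp]: "0 < skip_idx j i"
  by (simp add: skip_idx_def)

lemma drop_nth_upt:
  assumes "j \<le> n"
  shows "drop_nth j [1..<Suc (Suc n)] = map (skip_idx j) [0..<n]"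
proof (rule nth_equalityI)
  show "length (drop_nth j [1..<Suc (Suc n)]) = length (map (skip_idx j) [0..<n])"
    using assms by (simp add: length_drop_nth)
  fix i assume "i < length (drop_nth j [1..<Suc (Suc n)])"
  then have "i < n" using assms by (simp add: length_drop_nth del: upt_Suc)
  then show "drop_nth j [1..<Suc (Suc n)] ! i = map (skip_idx j) [0..<n] ! i"
    using assms by (subst nth_drop_nth) (auto simp: skip_idx_def simp del: upt_Suc)
qed

text \<open>The permutation \<open>0, j + 1, 1, \<dots>, j, j + 2, \<dots>\<close> (in one-line notation).\<close>

primrec match_first :: "nat \<Rightarrow> nat \<Rightarrow> nat" where
  "match_first 0 = id"
| "match_first (Suc j) = transpose (Suc j) (Suc (Suc j)) \<circ> match_first j"

lemma match_first_apply [simp]: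
  "match_first j 0 = 0" "match_first j (Suc 0) = Suc j" "match_first j (Suc (Suc i)) = skip_idx j i"
  by (induction j) (auto simp: skip_idx_def transpose_def)

lemma match_first_permutes: "j \<le> n \<Longrightarrow> match_first j permutes {..<Suc (Suc n)}"
  by (induction j) (auto intro!: permutes_compose permutes_swap_id)

lemma sign_match_first: "sign (match_first j) = (-1) ^ j"
proof (induction j)
  case (Suc j)
  have "permutation (match_first j)"
    using match_first_permutes[of j j] permutes_imp_permutation by blast
  then show ?case
    by (simp add: sign_compose permutation_swap_id sign_swap_id Suc.IH del: o_apply)
qed simp

text \<open>Followed by \<open>match_first j\<close>, this encodes the matching that pairs 0 with
  \<open>Suc j\<close> and treats the other indices, renumbered by \<open>skip_idx j\<close>, as
  \<open>\<tau>\<close> does.\<close>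

definition shift2 :: "(nat \<Rightarrow> nat) \<Rightarrow> nat \<Rightarrow> nat" where
  "shift2 \<tau> i = (if i < 2 then i else Suc (Suc (\<tau> (i - 2))))"

lemma shift2_apply [simp]:
  "shift2 \<tau> 0 = 0" "shift2 \<tau> (Suc 0) = Suc 0" "shift2 \<tau> (Suc (Suc i)) = Suc (Suc (\<tau> i))"
  by (simp_all add: shift2_def)

lemma shift2_conv_map_permutation:
  assumes "\<tau> permutes {..<n}"
  shows "shift2 \<tau> = map_permutation {..<n} (\<lambda>i. Suc (Suc i)) \<tau>"
proof
  fix i
  have inj: "inj_on (\<lambda>i. Suc (Suc i)) {..<n}" by (auto intro: inj_onI)
  show "shift2 \<tau> i = map_permutation {..<n} (\<lambda>i. Suc (Suc i)) \<tau> i"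
  proof (cases "i \<in> (\<lambda>i. Suc (Suc i)) ` {..<n}")
    case True
    then show ?thesis
      using map_permutation_apply[OF inj] by auto
  next
    case False
    have "i < 2 \<or> i - 2 \<ge> n \<and> i \<ge> 2"
    proof (rule ccontr)
      assume "\<not> (i < 2 \<or> i - 2 \<ge> n \<and> i \<ge> 2)"
      then have "i = Suc (Suc (i - 2))" "i - 2 \<in> {..<n}" by auto
      with False show False by blast
    qed
    then have "shift2 \<tau> i = i"
      using assms by (auto simp: shift2_def permutes_not_in)
    with False show ?thesis
      by (simp add: map_permutation_def restrict_id_def)
  qed
qed

lemma shift2_permutes:
  assumes "\<tau> permutes {..<n}"
  shows "shift2 \<tau> permutes {..<Suc (Suc n)}"
proof -
  have "bij_betw (\<lambda>i. Suc (Suc i)) {..<n} ((\<lambda>i. Suc (Suc i)) ` {..<n})"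
    by (rule inj_on_imp_bij_betw) (auto intro: inj_onI)
  then have "shift2 \<tau> permutes (\<lambda>i. Suc (Suc i)) ` {..<n}"
    unfolding shift2_conv_map_permutation[OF assms] using assms
    by (intro map_permutation_permutes)
  then show ?thesis
    by (rule permutes_subset) auto
qed

lemma sign_shift2:
  assumes "\<tau> permutes {..<n}"
  shows "sign (shift2 \<tau>) = sign \<tau>"
  unfolding shift2_conv_map_permutation[OF assms]
  by (rule sign_map_permutation) (use assms in \<open>auto intro: inj_onI\<close>)

text \<open>Both order conditions pass back and forth because \<open>skip_idx j\<close> is
  increasing. The added pair satisfies them by itself, since its first element is 0.\<close>

lemma match_first_shift2_mem_iff:
  assumes "\<tau> permutes {..<n}" "j \<le> n"
  shows "match_first j \<circ> shift2 \<tau> \<in> matchings (Suc (Suc n)) \<longleftrightarrow> \<tau> \<in> matchings n"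
proof -
  let ?\<sigma> = "match_first j \<circ> shift2 \<tau>"
  have perm: "?\<sigma> permutes {..<Suc (Suc n)}"
    using assms by (intro permutes_compose shift2_permutes match_first_permutes)
  have 1: "(\<forall>i < Suc (Suc n) div 2. ?\<sigma> (2 * i) < ?\<sigma> (2 * i + 1)) \<longleftrightarrow> (\<forall>i < n div 2. \<tau> (2 * i) < \<tau> (2 * i + 1))"
    by (simp add: All_less_Suc2)
  have 2: "(\<forall>i k. i < k \<and> k < Suc (Suc n) div 2 \<longrightarrow> ?\<sigma> (2 * i) < ?\<sigma> (2 * k)) \<longleftrightarrow>
      (\<forall>i k. i < k \<and> k < n div 2 \<longrightarrow> \<tau> (2 * i) < \<tau> (2 * k))" (is "?L \<longleftrightarrow> ?R")
  proof
    assume L: ?L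
    show ?R
    proof (intro allI impI)
      fix i k assume "i < k \<and> k < n div 2"
      then show "\<tau> (2 * i) < \<tau> (2 * k)"
        using L[rule_format, of "Suc i" "Suc k"] by simp
    qed
  next
    assume R: ?R
    show ?L
    proof (intro allI impI)
      fix i k assume ik: "i < k \<and> k < Suc (Suc n) div 2"
      then obtain k' where k: "k = Suc k'" by (cases k) auto
      show "?\<sigma> (2 * i) < ?\<sigma> (2 * k)"
        using R ik by (cases i) (auto simp: k)
    qed
  qed
  show ?thesis
    unfolding matchings_def mem_Collect_eq 1 2 using perm assms by simp
qed

lemma matchings_Suc_SucE:
  assumes "\<sigma> \<in> matchings (Suc (Suc n))" "even n"
  obtains j \<tau> where "j \<le> n" "\<tau> \<in> matchings n" "\<sigma> = match_first j \<circ> shift2 \<tau>"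
proof -
  have perm: "\<sigma> permutes {..<Suc (Suc n)}"
    and m1: "\<And>i. i < Suc (Suc n) div 2 \<Longrightarrow> \<sigma> (2 * i) < \<sigma> (2 * i + 1)"
    and m2: "\<And>i k. i < k \<Longrightarrow> k < Suc (Suc n) div 2 \<Longrightarrow> \<sigma> (2 * i) < \<sigma> (2 * k)"
    using assms(1) unfolding matchings_def by auto
  have \<sigma>0: "\<sigma> 0 = 0"
  \<comment> \<open>The value 0 at an odd position would violate the order within its pair, and at a
    positive even position the order of the first elements. Evenness of \<open>n\<close> guarantees
    that every position belongs to a pair.\<close>
  proof -
    obtain p where p: "p < Suc (Suc n)" "\<sigma> p = 0"
      using permutes_surj[OF perm] permutes_in_image[OF perm] by (metis lessThan_iff surjD zero_less_Suc)
    show ?thesis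
    proof (cases "even p")
      case True
      then obtain i where i: "p = 2 * i" by blast
      show ?thesis
        using m2[of 0 i] i p assms(2) by (cases "i = 0") auto
    next
      case False
      then obtain i where i: "p = 2 * i + 1" by (elim oddE)
      show ?thesis
        using m1[of i] i p assms(2) by auto
    qed
  qed
  define j where "j = \<sigma> 1 - 1"
  have \<sigma>1: "\<sigma> 1 = Suc j"
    using m1[of 0] by (simp add: j_def)
  have "\<sigma> 1 < Suc (Suc n)"
    using permutes_in_image[OF perm, of 1] by simp
  with \<sigma>1 have j: "j \<le> n" by simp
  \<comment> \<open>Undoing \<open>match_first j\<close> leaves a permutation that fixes 0 and 1,
    hence one of the form \<open>shift2 \<tau>\<close>.\<close>
  define \<rho> where "\<rho> = Hilbert_Choice.inv (match_first j) \<circ> \<sigma>"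
  note mp = match_first_permutes[OF j]
  have \<rho>perm: "\<rho> permutes {..<Suc (Suc n)}"
    unfolding \<rho>_def by (rule permutes_compose[OF perm permutes_inv[OF mp]])
  have \<rho>\<sigma>: "match_first j \<circ> \<rho> = \<sigma>"
    unfolding \<rho>_def using permutes_inv_o(1)[OF mp] by (simp add: o_assoc)
  have \<rho>01: "\<rho> 0 = 0" "\<rho> 1 = 1"
    unfolding \<rho>_def using \<sigma>0 \<sigma>1 permutes_inv_eq[OF mp] by auto
  have \<rho>2: "\<rho> (Suc (Suc i)) \<ge> 2" for i
  proof -
    have "\<rho> (Suc (Suc i)) \<noteq> \<rho> 0" "\<rho> (Suc (Suc i)) \<noteq> \<rho> 1"
      using permutes_inj[OF \<rho>perm] by (auto dest: injD)
    then show ?thesis using \<rho>01 by linarith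
  qed
  define \<tau> where "\<tau> = (\<lambda>i. \<rho> (Suc (Suc i)) - 2)"
  have \<tau>: "\<rho> (Suc (Suc i)) = Suc (Suc (\<tau> i))" for i
    using \<rho>2[of i] by (simp add: \<tau>_def)
  have \<rho>sh: "\<rho> = shift2 \<tau>"
  proof
    fix i show "\<rho> i = shift2 \<tau> i"
      using \<rho>01 \<tau>[of "i - 2"] by (cases i rule: nat.exhaust; cases "i - 1") auto
  qed
  have \<tau>perm: "\<tau> permutes {..<n}"
  proof (rule bij_imp_permutes)
    have "inj_on \<tau> {..<n}"
    proof (rule inj_onI)
      fix a b assume "\<tau> a = \<tau> b"
      then have "\<rho> (Suc (Suc a)) = \<rho> (Suc (Suc b))" by (simp add: \<tau>)
      then show "a = b" using permutes_inj[OF \<rho>perm] by (auto dest: injD)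
    qed
    moreover have "\<tau> ` {..<n} \<subseteq> {..<n}"
    proof (intro image_subsetI)
      fix a assume "a \<in> {..<n}"
      then have "\<rho> (Suc (Suc a)) < Suc (Suc n)"
        using permutes_in_image[OF \<rho>perm, of "Suc (Suc a)"] by auto
      then show "\<tau> a \<in> {..<n}" by (simp add: \<tau>)
    qed
    ultimately show "bij_betw \<tau> {..<n} {..<n}"
      by (simp add: bij_betw_def endo_inj_surj)
    fix a assume "a \<notin> {..<n}"
    then have "\<rho> (Suc (Suc a)) = Suc (Suc a)"
      using \<rho>perm by (intro permutes_not_in) auto
    then show "\<tau> a = a" by (simp add: \<tau>)
  qed
  have "\<tau> \<in> matchings n"
    using match_first_shift2_mem_iff[OF \<tau>perm j] assms(1) \<rho>\<sigma> \<rho>sh by simp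
  then show thesis
    using that[OF j] \<rho>\<sigma> \<rho>sh by simp
qed

definition pf_sum :: "nat \<Rightarrow> (nat \<Rightarrow> nat \<Rightarrow> 'k::comm_ring_1) \<Rightarrow> 'k" where
  "pf_sum n a = (\<Sum>\<sigma>\<in>matchings n. of_int (sign \<sigma>) * (\<Prod>i<n div 2. a (\<sigma> (2 * i)) (\<sigma> (2 * i + 1))))"

text \<open>The matchings are grouped by the partner \<open>Suc j\<close> of 0. The sign of
  \<open>match_first j\<close> supplies \<open>(-1) ^ j\<close>, so this is the recursion that
  defines \<open>pf_list\<close>.\<close>

lemma pf_sum_Suc_Suc:
  assumes "even n"
  shows "pf_sum (Suc (Suc n)) a =
    (\<Sum>j<Suc n. (-1) ^ j * a 0 (Suc j) * pf_sum n (\<lambda>i k. a (skip_idx j i) (skip_idx j k)))"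
proof -
  let ?\<Phi> = "\<lambda>(j, \<tau>). match_first j \<circ> shift2 \<tau>"
  let ?g = "\<lambda>\<sigma>. of_int (sign \<sigma>) * (\<Prod>i<Suc (Suc n) div 2. a (\<sigma> (2 * i)) (\<sigma> (2 * i + 1)))"
  have perm: "\<tau> permutes {..<n}" if "\<tau> \<in> matchings n" for \<tau>
    using that by (simp add: matchings_def)
  have bij: "bij_betw ?\<Phi> ({..<Suc n} \<times> matchings n) (matchings (Suc (Suc n)))"
    unfolding bij_betw_def
  proof
    show "inj_on ?\<Phi> ({..<Suc n} \<times> matchings n)"
    proof (rule inj_onI)
      fix p q assume p: "p \<in> {..<Suc n} \<times> matchings n" and q: "q \<in> {..<Suc n} \<times> matchings n" and eq: "?\<Phi> p = ?\<Phi> q"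
      obtain j \<tau> j' \<tau>' where pq: "p = (j, \<tau>)" "q = (j', \<tau>')" by (cases p; cases q)
      have eq': "(match_first j \<circ> shift2 \<tau>) i = (match_first j' \<circ> shift2 \<tau>') i" for i
        using eq unfolding pq by (metis case_prod_conv)
      have j: "j = j'" using eq'[of "Suc 0"] by simp
      have "\<tau> i = \<tau>' i" for i
        using eq'[of "Suc (Suc i)"] unfolding j by (auto simp: skip_idx_def split: if_splits)
      then show "p = q" using j pq by auto
    qed
    show "?\<Phi> ` ({..<Suc n} \<times> matchings n) = matchings (Suc (Suc n))"
    proof (intro equalityI subsetI)
      fix \<sigma> assume "\<sigma> \<in> ?\<Phi> ` ({..<Suc n} \<times> matchings n)"
      then show "\<sigma> \<in> matchings (Suc (Suc n))"
        using match_first_shift2_mem_iff perm by auto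
    next
      fix \<sigma> assume "\<sigma> \<in> matchings (Suc (Suc n))"
      then show "\<sigma> \<in> ?\<Phi> ` ({..<Suc n} \<times> matchings n)"
        by (rule matchings_Suc_SucE) (use assms in \<open>force+\<close>)
    qed
  qed
  have "pf_sum (Suc (Suc n)) a = (\<Sum>p\<in>{..<Suc n} \<times> matchings n. ?g (?\<Phi> p))"
    unfolding pf_sum_def by (rule sum.reindex_bij_betw[OF bij, symmetric])
  also have "\<dots> = (\<Sum>(j,\<tau>)\<in>{..<Suc n} \<times> matchings n. (-1) ^ j * a 0 (Suc j) * (of_int (sign \<tau>) *
      (\<Prod>i<n div 2. a (skip_idx j (\<tau> (2 * i))) (skip_idx j (\<tau> (2 * i + 1))))))"
  proof (rule sum.cong[OF refl], clarify)
    fix j \<tau> assume "j < Suc n" "\<tau> \<in> matchings n"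
    then have sg: "sign (match_first j \<circ> shift2 \<tau>) = (-1) ^ j * sign \<tau>"
      using perm[of \<tau>] match_first_permutes[of j n] shift2_permutes[of \<tau> n]
      by (subst sign_compose) (auto simp: sign_match_first sign_shift2 intro: permutes_imp_permutation)
    have d: "Suc (Suc n) div 2 = Suc (n div 2)" by simp
    show "of_int (sign (match_first j \<circ> shift2 \<tau>)) *
        (\<Prod>i<Suc (Suc n) div 2. a ((match_first j \<circ> shift2 \<tau>) (2 * i)) ((match_first j \<circ> shift2 \<tau>) (2 * i + 1))) =
        (-1) ^ j * a 0 (Suc j) * (of_int (sign \<tau>) * (\<Prod>i<n div 2. a (skip_idx j (\<tau> (2 * i))) (skip_idx j (\<tau> (2 * i + 1)))))"
      unfolding sg d prod.lessThan_Suc_shift by (simp add: mult_ac)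
  qed
  also have "\<dots> = (\<Sum>j<Suc n. (-1) ^ j * a 0 (Suc j) * pf_sum n (\<lambda>i k. a (skip_idx j i) (skip_idx j k)))"
    unfolding pf_sum_def sum_distrib_left sum.cartesian_product by simp
  finally show ?thesis .
qed

lemma matchings_0: "matchings 0 = {id}"
  by (auto simp: matchings_def)

lemma pf_sum_conv_pf_list: "even n \<Longrightarrow> pf_sum n a = pf_list a [0..<n]"
proof (induction "n div 2" arbitrary: n a)
  case 0
  then have "n = 0" by auto
  then show ?case by (simp add: pf_sum_def matchings_0)
next
  case (Suc k)
  then obtain n' where n: "n = Suc (Suc n')" "even n'"
    by (metis even_Suc_Suc_iff div_eq_0_iff numeral_2_eq_2 less_2_cases_iff nat.distinct(1) not0_implies_Suc not_less_eq zero_less_Suc One_nat_def odd_one)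
  have "pf_sum n a = (\<Sum>j<Suc n'. (-1) ^ j * a 0 (Suc j) * pf_list (\<lambda>i k. a (skip_idx j i) (skip_idx j k)) [0..<n'])"
    unfolding n(1) pf_sum_Suc_Suc[OF n(2)] using Suc n by simp
  also have "\<dots> = (\<Sum>j<Suc n'. (-1) ^ j * a 0 (Suc j) * pf_list a (drop_nth j [1..<Suc (Suc n')]))"
    by (rule sum.cong) (simp_all add: drop_nth_upt[unfolded One_nat_def] pf_list_map del: upt_Suc)
  also have "\<dots> = pf_list a (0 # [1..<Suc (Suc n')])"
    by (simp add: pf_list.simps(2) del: upt_Suc)
  also have "0 # [1..<Suc (Suc n')] = [0..<n]"
    unfolding n(1) by (simp add: upt_conv_Cons del: upt_Suc)
  finally show ?case .
qed

text \<open>Parity matters: \<open>pf_list\<close> is 0 on lists of odd length, whereas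
  \<open>Pf\<close> is 1 on every 1 by 1 matrix, where the product over pairs is empty.\<close>

theorem Pf_conv_pf_list:
  assumes "even (dim_row A)"
  shows "Pf A = pf_list (\<lambda>i j. A $$ (i, j)) [0..<dim_row A]"
  using pf_sum_conv_pf_list[OF assms, of "\<lambda>i j. A $$ (i, j)"] by (simp add: Pf_def pf_sum_def)

section \<open>The minor summation formula\<close>

lemma prod_list_map2_drop_nth:
  fixes b :: "'a \<Rightarrow> 'b \<Rightarrow> 'k::comm_monoid_mult"
  assumes "length ks = length xs" "j < length xs"
  shows "prod_list (map2 b xs ks) = b (xs ! j) (ks ! j) * prod_list (map2 b (drop_nth j xs) (drop_nth j ks))"
  using assms
proof (induction xs ks arbitrary: j rule: list_induct2')
  case (4 x xs k ks)
  then show ?case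
    by (cases j) (auto simp: mult.left_commute)
qed auto

lemma sum_lists_Suc:
  "(\<Sum>ks\<in>{ks. set ks \<subseteq> K \<and> length ks = Suc n}. g ks) =
   (\<Sum>k\<in>K. \<Sum>ks\<in>{ks. set ks \<subseteq> K \<and> length ks = n}. g (k # ks))"
  unfolding sum.cartesian_product
  by (rule sum.reindex_bij_witness[of _ "\<lambda>(k, ks). k # ks" "\<lambda>ks. (hd ks, tl ks)"])
    (auto simp: length_Suc_conv)

lemma sum_lists_nth_drop_nth:
  assumes "j < n"
  shows "(\<Sum>ks\<in>{ks. set ks \<subseteq> K \<and> length ks = n}. g (ks ! j) (drop_nth j ks)) =
   (\<Sum>k\<in>K. \<Sum>ks\<in>{ks. set ks \<subseteq> K \<and> length ks = n - 1}. g k ks)"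
  unfolding sum.cartesian_product
proof (rule sum.reindex_bij_witness[of _ "\<lambda>(k, ks). take j ks @ k # drop j ks" "\<lambda>ks. (ks ! j, drop_nth j ks)"])
  fix p assume "p \<in> K \<times> {ks. set ks \<subseteq> K \<and> length ks = n - 1}"
  then obtain k ks where p: "p = (k, ks)" "k \<in> K" "set ks \<subseteq> K" "length ks = n - 1" by auto
  then show "(\<lambda>ks. (ks ! j, drop_nth j ks)) (case p of (k, ks) \<Rightarrow> take j ks @ k # drop j ks) = p"
    using assms by (simp add: nth_append drop_nth_def)
  show "(case p of (k, ks) \<Rightarrow> take j ks @ k # drop j ks) \<in> {ks. set ks \<subseteq> K \<and> length ks = n}"
    using p assms by (auto dest: in_set_takeD in_set_dropD)
next
  fix ks assume ks: "ks \<in> {ks. set ks \<subseteq> K \<and> length ks = n}"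
  then show "(case (ks ! j, drop_nth j ks) of (k, ks) \<Rightarrow> take j ks @ k # drop j ks) = ks"
    using assms by (simp add: drop_nth_def id_take_nth_drop[symmetric])
  show "(ks ! j, drop_nth j ks) \<in> K \<times> {ks. set ks \<subseteq> K \<and> length ks = n - 1}"
    using ks assms set_drop_nth_subset[of j ks] by (auto simp: length_drop_nth)
qed auto

text \<open>Multilinearity alone: every row index \<open>i\<close> selects one column index, and
  \<open>a\<close> is evaluated at the selected ones. Alternation enters only later, when the lists
  \<open>ks\<close> are sorted by their sets.\<close>

lemma pf_list_bilinear_expand:
  fixes a :: "'b \<Rightarrow> 'b \<Rightarrow> 'k::comm_ring_1" and b :: "'a \<Rightarrow> 'b \<Rightarrow> 'k"
  shows "pf_list (\<lambda>i j. \<Sum>k\<in>K. \<Sum>l\<in>K. b i k * a k l * b j l) xs =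
    (\<Sum>ks\<in>{ks. set ks \<subseteq> K \<and> length ks = length xs}. prod_list (map2 b xs ks) * pf_list a ks)"
proof (induction xs rule: length_induct)
  case (1 xs)
  let ?L = "\<lambda>n. {ks. set ks \<subseteq> K \<and> length ks = n}"
  let ?c = "\<lambda>i j. \<Sum>k\<in>K. \<Sum>l\<in>K. b i k * a k l * b j l"
  show ?case
  proof (cases xs)
    case Nil
    then show ?thesis by (simp cong: conj_cong)
  next
    case (Cons x ys)
    define n where "n = length ys"
    let ?t = "\<lambda>j k l ks. (-1) ^ j * (b x k * a k l * b (ys ! j) l) * (prod_list (map2 b (drop_nth j ys) ks) * pf_list a ks)"
    have "pf_list ?c xs = (\<Sum>j<n. (-1) ^ j * ?c x (ys ! j) *
        (\<Sum>ks\<in>?L (n - 1). prod_list (map2 b (drop_nth j ys) ks) * pf_list a ks))"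
      unfolding Cons pf_list.simps(2) n_def
    proof (rule sum.cong[OF refl])
      fix j assume "j \<in> {..<length ys}"
      then show "(-1) ^ j * ?c x (ys ! j) * pf_list ?c (drop_nth j ys) = (-1) ^ j * ?c x (ys ! j) *
        (\<Sum>ks\<in>?L (length ys - 1). prod_list (map2 b (drop_nth j ys) ks) * pf_list a ks)"
        using 1[rule_format, of "drop_nth j ys"] by (simp add: Cons length_drop_nth)
    qed
    also have "\<dots> = (\<Sum>j<n. \<Sum>k\<in>K. \<Sum>l\<in>K. \<Sum>ks\<in>?L (n - 1). ?t j k l ks)"
      by (simp only: sum_distrib_left[symmetric] sum_distrib_right[symmetric])
    \<comment> \<open>The index \<open>l\<close> selected by \<open>ys ! j\<close> is inserted at
      position \<open>j\<close> of the list selected by the remaining rows. The sum over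
      \<open>j\<close> then becomes the first row expansion of
      \<open>pf_list a (k # ks)\<close>.\<close>
    also have "\<dots> = (\<Sum>j<n. \<Sum>k\<in>K. \<Sum>ks\<in>?L n. ?t j k (ks ! j) (drop_nth j ks))"
      by (intro sum.cong refl) (simp add: sum_lists_nth_drop_nth[where g = "?t _ _"])
    also have "\<dots> = (\<Sum>j<n. \<Sum>k\<in>K. \<Sum>ks\<in>?L n. prod_list (map2 b xs (k # ks)) * ((-1) ^ j * a k (ks ! j) * pf_list a (drop_nth j ks)))"
    proof (intro sum.cong refl)
      fix j k ks assume "j \<in> {..<n}" "ks \<in> ?L n"
      then have "prod_list (map2 b ys ks) = b (ys ! j) (ks ! j) * prod_list (map2 b (drop_nth j ys) (drop_nth j ks))"
        by (intro prod_list_map2_drop_nth) (auto simp: n_def)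
      then show "?t j k (ks ! j) (drop_nth j ks) = prod_list (map2 b xs (k # ks)) * ((-1) ^ j * a k (ks ! j) * pf_list a (drop_nth j ks))"
        by (simp add: Cons mult_ac)
    qed
    also have "\<dots> = (\<Sum>k\<in>K. \<Sum>ks\<in>?L n. \<Sum>j<n. prod_list (map2 b xs (k # ks)) * ((-1) ^ j * a k (ks ! j) * pf_list a (drop_nth j ks)))"
      by (subst sum.swap, rule sum.cong[OF refl], rule sum.swap)
    also have "\<dots> = (\<Sum>k\<in>K. \<Sum>ks\<in>?L n. prod_list (map2 b xs (k # ks)) * pf_list a (k # ks))"
      by (intro sum.cong refl) (simp add: pf_list.simps(2) sum_distrib_left)
    also have "\<dots> = (\<Sum>ks\<in>?L (Suc n). prod_list (map2 b xs ks) * pf_list a ks)"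
      by (rule sum_lists_Suc[symmetric])
    finally show ?thesis by (simp add: Cons n_def)
  qed
qed

lemma bij_betw_permute_list:
  assumes "distinct s"
  shows "bij_betw (\<lambda>p. permute_list p s) {p. p permutes {..<length s}} {ks. distinct ks \<and> set ks = set s}"
  unfolding bij_betw_def
proof (intro conjI equalityI subsetI)
  show "inj_on (\<lambda>p. permute_list p s) {p. p permutes {..<length s}}"
  proof (rule inj_onI, clarify)
    fix p q assume pq: "p permutes {..<length s}" "q permutes {..<length s}" "permute_list p s = permute_list q s"
    show "p = q"
    proof
      fix i show "p i = q i"
      proof (cases "i < length s")
        case True
        then have "s ! p i = s ! q i"
          using permute_list_nth[OF pq(1) True] permute_list_nth[OF pq(2) True] pq(3) by simp
        moreover have "p i < length s" "q i < length s"
          using True permutes_in_image[OF pq(1), of i] permutes_in_image[OF pq(2), of i] by simp_all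
        ultimately show ?thesis
          using nth_eq_iff_index_eq[OF assms] by simp
      qed (use pq in \<open>simp add: permutes_not_in\<close>)
    qed
  qed
next
  fix ks assume "ks \<in> {ks. distinct ks \<and> set ks = set s}"
  then have "mset ks = mset s"
    using assms set_eq_iff_mset_eq_distinct by blast
  then obtain p where "p permutes {..<length s}" "permute_list p s = ks"
    by (rule mset_eq_permutation)
  then show "ks \<in> (\<lambda>p. permute_list p s) ` {p. p permutes {..<length s}}" by blast
qed (use assms in auto)

lemma prod_list_map2_nth:
  "length ks = length xs \<Longrightarrow> prod_list (map2 b xs ks) = (\<Prod>i<length xs. b (xs ! i) (ks ! i))"
  for b :: "'a \<Rightarrow> 'b \<Rightarrow> 'k::comm_monoid_mult"
  by (simp add: prod.list_conv_set_nth atLeast0LessThan)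

text \<open>In the multilinear expansion alternation removes the lists with a repetition. Those with
  a given set \<open>K\<close> of entries are the rearrangements of the increasing list of
  \<open>K\<close>; their signs factor out of the Pfaffian and assemble the Leibniz sum of the
  minor.\<close>

lemma pf_list_minor_summation:
  fixes a :: "nat \<Rightarrow> nat \<Rightarrow> 'k::comm_ring_1" and b :: "nat \<Rightarrow> nat \<Rightarrow> 'k"
  assumes "alternating a"
  shows "pf_list (\<lambda>i j. \<Sum>k<N. \<Sum>l<N. b i k * a k l * b j l) [0..<m] =
    (\<Sum>K | K \<subseteq> {..<N} \<and> card K = m. pf_list a (nths [0..<N] K) *
        det (mat m m (\<lambda>(i,j). b i (nths [0..<N] K ! j))))"
proof -
  let ?L = "{ks. set ks \<subseteq> {..<N} \<and> length ks = m}"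
  let ?D = "{ks. set ks \<subseteq> {..<N} \<and> length ks = m \<and> distinct ks}"
  let ?T = "{K. K \<subseteq> {..<N} \<and> card K = m}"
  let ?h = "\<lambda>ks. prod_list (map2 b [0..<m] ks) * pf_list a ks"
  have finL: "finite ?L" by (rule finite_lists_length_eq) simp
  have finT: "finite ?T" by (rule finite_subset[of _ "Pow {..<N}"]) auto
  have "pf_list (\<lambda>i j. \<Sum>k<N. \<Sum>l<N. b i k * a k l * b j l) [0..<m] = sum ?h ?L"
    by (simp add: pf_list_bilinear_expand)
  also have "\<dots> = sum ?h ?D"
    by (rule sum.mono_neutral_right) (use finL pf_list_not_distinct[OF assms] in auto)
  also have "\<dots> = (\<Sum>K\<in>?T. sum ?h {ks \<in> ?D. set ks = K})"
    by (rule sum.group[symmetric]) (use finite_subset[OF _ finL, of ?D] finT in \<open>auto simp: distinct_card\<close>)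
  also have "\<dots> = (\<Sum>K\<in>?T. pf_list a (nths [0..<N] K) * det (mat m m (\<lambda>(i,j). b i (nths [0..<N] K ! j))))"
  proof (rule sum.cong[OF refl])
    fix K assume "K \<in> ?T"
    then have K: "K \<subseteq> {..<N}" "card K = m" by auto
    define s where "s = nths [0..<N] K"
    have ds: "distinct s" by (simp add: s_def)
    have ss: "set s = K"
      using K(1) by (force simp: s_def set_nths)
    have ls: "length s = m"
      using distinct_card[OF ds] ss K by simp
    have eq: "{ks \<in> ?D. set ks = K} = {ks. distinct ks \<and> set ks = set s}"
      using K ss by (auto simp: distinct_card dest: distinct_card)
    have "sum ?h {ks \<in> ?D. set ks = K} = (\<Sum>p | p permutes {..<m}. ?h (permute_list p s))"
      unfolding eq using sum.reindex_bij_betw[OF bij_betw_permute_list[OF ds], of ?h, symmetric] unfolding ls .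
    also have "\<dots> = (\<Sum>p | p permutes {..<m}. pf_list a s * (of_int (sign p) * (\<Prod>i<m. b i (s ! p i))))"
    proof (rule sum.cong[OF refl])
      fix p assume "p \<in> {p. p permutes {..<m}}"
      then have p: "p permutes {..<length s}" by (simp add: ls)
      have "prod_list (map2 b [0..<m] (permute_list p s)) = (\<Prod>i<m. b i (s ! p i))"
        by (subst prod_list_map2_nth) (auto simp: ls permute_list_nth[OF p] intro!: prod.cong)
      then show "?h (permute_list p s) = pf_list a s * (of_int (sign p) * (\<Prod>i<m. b i (s ! p i)))"
        using pf_list_permute_list[OF assms p] by (simp add: mult_ac)
    qed
    also have "\<dots> = pf_list a s * det (mat m m (\<lambda>(i,j). b i (s ! j)))"
      unfolding sum_distrib_left[symmetric]
    proof (rule arg_cong[of _ _ "(*) (pf_list a s)"])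
      have "det (mat m m (\<lambda>(i,j). b i (s ! j))) =
          (\<Sum>p | p permutes {0..<m}. signof p * (\<Prod>i = 0..<m. mat m m (\<lambda>(i,j). b i (s ! j)) $$ (i, p i)))"
        by (rule det_def') simp
      also have "\<dots> = (\<Sum>p | p permutes {..<m}. of_int (sign p) * (\<Prod>i<m. b i (s ! p i)))"
        unfolding atLeast0LessThan
      proof (intro sum.cong refl arg_cong2[of _ _ _ _ "(*)"] prod.cong)
        fix p i assume "p \<in> {p. p permutes {..<m}}" "i \<in> {..<m}"
        then have "i < m" "p i < m"
          using permutes_in_image[of p "{..<m}" i] by auto
        then show "mat m m (\<lambda>(i,j). b i (s ! j)) $$ (i, p i) = b i (s ! p i)" by simp
      qed
      finally show "(\<Sum>p | p permutes {..<m}. of_int (sign p) * (\<Prod>i<m. b i (s ! p i))) =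
          det (mat m m (\<lambda>(i,j). b i (s ! j)))" by simp
    qed
    finally show "sum ?h {ks \<in> ?D. set ks = K} = pf_list a (nths [0..<N] K) * det (mat m m (\<lambda>(i,j). b i (nths [0..<N] K ! j)))"
      unfolding s_def .
  qed
  finally show ?thesis .
qed

text \<open>
  Entries outside a matrix are unspecified, so alternation of the entry function requires
  extending it by \<open>0\<close>.
\<close>

definition mat_fun :: "'k::zero mat \<Rightarrow> nat \<Rightarrow> nat \<Rightarrow> 'k" where
  "mat_fun A i j = (if i < dim_row A \<and> j < dim_col A then A $$ (i, j) else 0)"

lemma alternating_mat_fun:
  assumes "skew_symmetric A"
  shows "alternating (mat_fun A)"
proof -
  have sq: "dim_col A = dim_row A" and t: "transpose_mat A = - A" and d: "\<forall>i<dim_row A. A $$ (i, i) = 0"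
    using assms by (auto simp: skew_symmetric_def)
  have *: "A $$ (i, j) = - A $$ (j, i)" if "i < dim_row A" "j < dim_row A" for i j
    using arg_cong[OF t, of "\<lambda>M. M $$ (j, i)"] that sq by simp
  show ?thesis
    unfolding alternating_def
  proof (intro conjI allI)
    show "mat_fun A i i = 0" for i
      using d by (simp add: mat_fun_def)
    show "mat_fun A i j = - mat_fun A j i" for i j
      using *[of i j] sq by (simp add: mat_fun_def)
  qed
qed

lemma Pf_conv_pf_list_mat_fun:
  assumes "even (dim_row A)" "square_mat A"
  shows "Pf A = pf_list (mat_fun A) [0..<dim_row A]"
  unfolding Pf_conv_pf_list[OF assms(1)] using assms(2)
  by (intro pf_list_cong) (auto simp: mat_fun_def)

lemma nths_upt_conv_pick:
  assumes "K \<subseteq> {..<N}"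
  shows "nths [0..<N] K = map (pick K) [0..<card K]"
proof (rule nth_equalityI)
  have c: "{i. i < N \<and> i \<in> K} = K" using assms by auto
  show "length (nths [0..<N] K) = length (map (pick K) [0..<card K])"
    by (simp add: length_nths c)
  fix i assume "i < length (nths [0..<N] K)"
  then have i: "i < card K" by (simp add: length_nths c)
  then have "pick K i < N"
    using pick_in_set_le[OF i] assms by auto
  then show "nths [0..<N] K ! i = map (pick K) [0..<card K] ! i"
    using i nth_nths[of i "[0..<N]" K] by (simp add: c)
qed

lemma Pf_submatrix:
  assumes "square_mat A" "K \<subseteq> {..<dim_row A}" "even (card K)"
  shows "Pf (submatrix A K K) = pf_list (mat_fun A) (nths [0..<dim_row A] K)"
proof -
  have c: "{i. i < dim_row A \<and> i \<in> K} = K" using assms by auto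
  have d: "dim_row (submatrix A K K) = card K"
    by (simp add: dim_submatrix c)
  have "Pf (submatrix A K K) = pf_list (\<lambda>i j. submatrix A K K $$ (i, j)) [0..<card K]"
    using Pf_conv_pf_list[of "submatrix A K K"] assms by (simp add: d)
  also have "\<dots> = pf_list (\<lambda>i j. mat_fun A (pick K i) (pick K j)) [0..<card K]"
  proof (rule pf_list_cong)
    fix i j assume "i \<in> set [0..<card K]" "j \<in> set [0..<card K]"
    then have ij: "i < card K" "j < card K" by auto
    then have "pick K i < dim_row A" "pick K j < dim_row A"
      using pick_in_set_le assms(2) by blast+
    then show "submatrix A K K $$ (i, j) = mat_fun A (pick K i) (pick K j)"
      using ij assms(1) by (simp add: submatrix_index c mat_fun_def)
  qed
  also have "\<dots> = pf_list (mat_fun A) (nths [0..<dim_row A] K)"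
    by (simp add: nths_upt_conv_pick[OF assms(2)] pf_list_map)
  finally show ?thesis .
qed

theorem Pf_minor_summation:
  fixes A B :: "'k::comm_ring_1 mat"
  assumes A: "A \<in> carrier_mat N N" "skew_symmetric A" and B: "B \<in> carrier_mat m N" and m: "even m"
  shows "Pf (B * A * transpose_mat B) =
    (\<Sum>K | K \<subseteq> {..<N} \<and> card K = m. Pf (submatrix A K K) * det (mat m m (\<lambda>(i,j). B $$ (i, pick K j))))"
proof -
  let ?b = "\<lambda>i k. B $$ (i, k)"
  have "Pf (B * A * transpose_mat B) = pf_list (\<lambda>i j. (B * A * transpose_mat B) $$ (i, j)) [0..<m]"
    using Pf_conv_pf_list[of "B * A * transpose_mat B"] B m by simp
  also have "\<dots> = pf_list (\<lambda>i j. \<Sum>k<N. \<Sum>l<N. ?b i k * mat_fun A k l * ?b j l) [0..<m]"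
  proof (rule pf_list_cong)
    fix i j assume "i \<in> set [0..<m]" "j \<in> set [0..<m]"
    then have ij: "i < m" "j < m" by auto
    have "(B * A * transpose_mat B) $$ (i, j) = (B * (A * transpose_mat B)) $$ (i, j)"
      using A B by simp
    also have "\<dots> = (\<Sum>k<N. ?b i k * (\<Sum>l<N. mat_fun A k l * ?b j l))"
      using A B ij by (simp add: scalar_prod_def mat_fun_def atLeast0LessThan)
    finally show "(B * A * transpose_mat B) $$ (i, j) = (\<Sum>k<N. \<Sum>l<N. ?b i k * mat_fun A k l * ?b j l)"
      by (simp add: sum_distrib_left mult.assoc)
  qed
  also have "\<dots> = (\<Sum>K | K \<subseteq> {..<N} \<and> card K = m. pf_list (mat_fun A) (nths [0..<N] K) *
        det (mat m m (\<lambda>(i,j). ?b i (nths [0..<N] K ! j))))"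
    by (rule pf_list_minor_summation[OF alternating_mat_fun[OF A(2)]])
  also have "\<dots> = (\<Sum>K | K \<subseteq> {..<N} \<and> card K = m. Pf (submatrix A K K) * det (mat m m (\<lambda>(i,j). B $$ (i, pick K j))))"
  proof (rule sum.cong[OF refl], clarify)
    fix K assume K: "K \<subseteq> {..<N}" "m = card K"
    have "mat m m (\<lambda>(i,j). ?b i (nths [0..<N] K ! j)) = mat m m (\<lambda>(i,j). B $$ (i, pick K j))"
      by (rule eq_matI) (auto simp: nths_upt_conv_pick[OF K(1)] K(2))
    then show "pf_list (mat_fun A) (nths [0..<N] K) * det (mat (card K) (card K) (\<lambda>(i,j). ?b i (nths [0..<N] K ! j))) =
       Pf (submatrix A K K) * det (mat (card K) (card K) (\<lambda>(i,j). B $$ (i, pick K j)))"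
      using Pf_submatrix[of A K] A K m by simp
  qed
  finally show ?thesis .
qed

text \<open>For a square \<open>B\<close> the only index set of the right size is the full one, so
  the minor summation formula has a single term.\<close>

corollary Pf_congruence:
  fixes A B :: "'k::comm_ring_1 mat"
  assumes A: "A \<in> carrier_mat n n" "skew_symmetric A" and B: "B \<in> carrier_mat n n" and n: "even n"
  shows "Pf (B * A * transpose_mat B) = det B * Pf A"
proof -
  have K: "{K. K \<subseteq> {..<n} \<and> card K = n} = {{..<n}}"
    using card_subset_eq[of "{..<n}"] by auto
  have nths: "nths [0..<n] {..<n} = [0..<n]"
    by (rule nths_all) auto
  have pick: "pick {..<n} j = j" if "j < n" for j
    using nths_upt_conv_pick[of "{..<n}" n] that unfolding nths by (simp add: map_eq_conv[symmetric] map_nth list_eq_iff_nth_eq)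
  have "mat n n (\<lambda>(i,j). B $$ (i, pick {..<n} j)) = B"
    using B by (intro eq_matI) (auto simp: pick)
  moreover have "Pf (submatrix A {..<n} {..<n}) = Pf A"
    using Pf_submatrix[of A "{..<n}"] Pf_conv_pf_list_mat_fun[of A] A n by (simp add: nths)
  ultimately show ?thesis
    unfolding Pf_minor_summation[OF A B n] K by simp
qed

section \<open>Schur complements and copfaffians\<close>

text \<open>The terms for \<open>(k, l)\<close> and \<open>(l, k)\<close> cancel. This provides the
  zero diagonal of a congruent matrix, which skewness under transposition does not give in
  characteristic 2.\<close>

lemma alternating_diag_sum:
  fixes a :: "nat \<Rightarrow> nat \<Rightarrow> 'k::comm_ring_1"
  assumes "alternating a"
  shows "(\<Sum>k<N. \<Sum>l<N. b k * a k l * b l) = 0"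
proof (induction N)
  case (Suc N)
  have a0: "a N N = 0" using assms unfolding alternating_def by blast
  have "(\<Sum>k<Suc N. \<Sum>l<Suc N. b k * a k l * b l) =
      (\<Sum>k<N. b k * a k N * b N) + (\<Sum>l<N. b N * a N l * b l)"
    by (simp add: sum.distrib Suc.IH a0)
  also have "(\<Sum>l<N. b N * a N l * b l) = (\<Sum>l<N. - (b l * a l N * b N))"
  proof (rule sum.cong[OF refl])
    fix l
    have "a N l = - a l N" using assms unfolding alternating_def by blast
    then show "b N * a N l * b l = - (b l * a l N * b N)" by simp
  qed
  finally show ?case by (simp add: sum_negf)
qed simp

lemma skew_symmetric_congruence:
  assumes A: "A \<in> carrier_mat n n" "skew_symmetric A" and B: "B \<in> carrier_mat m n"
  shows "skew_symmetric (B * A * transpose_mat B)"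
proof -
  have tA: "transpose_mat A = - A" using A by (simp add: skew_symmetric_def)
  have "transpose_mat (B * A * transpose_mat B) = transpose_mat (transpose_mat B) * transpose_mat (B * A)"
    by (rule transpose_mult[of _ m n _ m]) (use A B in auto)
  also have "transpose_mat (B * A) = transpose_mat A * transpose_mat B"
    by (rule transpose_mult) (use A B in auto)
  also have "transpose_mat (transpose_mat B) * (transpose_mat A * transpose_mat B) = - (B * A * transpose_mat B)"
    unfolding tA using A B by (simp add: uminus_mult_left_mat uminus_mult_right_mat)
  finally have t: "transpose_mat (B * A * transpose_mat B) = - (B * A * transpose_mat B)" .
  have "(B * A * transpose_mat B) $$ (i, i) = 0" if "i < m" for i
  proof -
    have "(B * A * transpose_mat B) $$ (i, i) = (B * (A * transpose_mat B)) $$ (i, i)"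
      using A B by simp
    also have "\<dots> = (\<Sum>k<n. B $$ (i, k) * (\<Sum>l<n. mat_fun A k l * B $$ (i, l)))"
      using A B that by (simp add: scalar_prod_def mat_fun_def atLeast0LessThan)
    also have "\<dots> = (\<Sum>k<n. \<Sum>l<n. B $$ (i, k) * mat_fun A k l * B $$ (i, l))"
      by (simp add: sum_distrib_left mult.assoc)
    also have "\<dots> = 0"
      by (rule alternating_diag_sum[OF alternating_mat_fun[OF A(2)]])
    finally show ?thesis .
  qed
  then show ?thesis
    using t A B by (simp add: skew_symmetric_def)
qed

text \<open>The transpose of \<open>B\<close> equals \<open>B * A * transpose_mat B\<close>, so it
  is congruent to \<open>A\<close> and inherits skew-symmetry together with the zero
  diagonal.\<close>

lemma skew_symmetric_inverse:
  assumes A: "A \<in> carrier_mat n n" "skew_symmetric A" and B: "B \<in> carrier_mat n n"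
    and AB: "A * B = 1\<^sub>m n" and BA: "B * A = 1\<^sub>m n"
  shows "skew_symmetric B"
proof -
  have tA: "transpose_mat A = - A" using A by (simp add: skew_symmetric_def)
  have "transpose_mat A * transpose_mat B = 1\<^sub>m n"
    using transpose_mult[OF B A(1)] BA by simp
  then have 1: "- (A * transpose_mat B) = 1\<^sub>m n"
    unfolding tA using A B by (simp add: uminus_mult_left_mat)
  have "B * - (A * transpose_mat B) = B" unfolding 1 using B by simp
  moreover have "B * - (A * transpose_mat B) = - (B * (A * transpose_mat B))"
    by (rule uminus_mult_right_mat) (use A B in auto)
  ultimately have e1: "B = - (B * (A * transpose_mat B))" by simp
  have e2: "B * (A * transpose_mat B) = B * A * transpose_mat B"
    using A B by simp
  have e3: "B * A * transpose_mat B = transpose_mat B"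
    unfolding BA using B by simp
  have s: "skew_symmetric (transpose_mat B)"
    using skew_symmetric_congruence[OF A B] unfolding e3 .
  then have "transpose_mat (transpose_mat B) = - transpose_mat B" "\<forall>i<n. transpose_mat B $$ (i, i) = 0"
    using B by (auto simp: skew_symmetric_def)
  then have "B = - transpose_mat B" "\<forall>i<n. B $$ (i, i) = 0" using B by auto
  then have "transpose_mat B = - B"
    by (metis uminus_uminus_mat)
  with \<open>\<forall>i<n. B $$ (i, i) = 0\<close> show ?thesis
    using B by (auto simp: skew_symmetric_def)
qed

lemma Pf_four_block_diag:
  fixes A D :: "'k::comm_ring_1 mat"
  assumes A: "A \<in> carrier_mat m m" and D: "D \<in> carrier_mat n n" and ev: "even m" "even n"
  shows "Pf (four_block_mat A (0\<^sub>m m n) (0\<^sub>m n m) D) = Pf A * Pf D"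
proof -
  let ?M = "four_block_mat A (0\<^sub>m m n) (0\<^sub>m n m) D"
  let ?f = "\<lambda>i j. ?M $$ (i, j)"
  have split: "[0..<m + n] = [0..<m] @ map (\<lambda>i. i + m) [0..<n]"
    by (simp add: upt_add_eq_append[of 0 m n] map_add_upt add.commute)
  have "Pf ?M = pf_list ?f [0..<m + n]"
    using A D ev by (subst Pf_conv_pf_list) auto
  also have "\<dots> = pf_list ?f [0..<m] * pf_list ?f (map (\<lambda>i. i + m) [0..<n])"
    unfolding split by (rule pf_list_append_block) (use A D in auto)
  also have "pf_list ?f [0..<m] = pf_list (\<lambda>i j. A $$ (i, j)) [0..<m]"
    by (rule pf_list_cong) (use A D in auto)
  also have "\<dots> = Pf A"
    using A ev by (subst Pf_conv_pf_list) auto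
  also have "pf_list ?f (map (\<lambda>i. i + m) [0..<n]) = pf_list (\<lambda>i j. D $$ (i, j)) [0..<n]"
    unfolding pf_list_map by (rule pf_list_cong) (use A D in auto)
  also have "\<dots> = Pf D"
    using D ev by (subst Pf_conv_pf_list) auto
  finally show ?thesis .
qed

lemma skew_symmetric_four_block:
  assumes B: "B \<in> carrier_mat m n" and C: "C \<in> carrier_mat n n" "skew_symmetric C"
  shows "skew_symmetric (four_block_mat (0\<^sub>m m m) B (- transpose_mat B) C)"
proof -
  let ?M = "four_block_mat (0\<^sub>m m m) B (- transpose_mat B) C"
  have tC: "transpose_mat C = - C" and dC: "\<forall>i<n. C $$ (i, i) = 0"
    using C by (auto simp: skew_symmetric_def)
  have C': "C $$ (j, i) = - C $$ (i, j)" if "i < n" "j < n" for i j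
    using arg_cong[OF tC, of "\<lambda>M. M $$ (i, j)"] that C by simp
  have "transpose_mat ?M = - ?M"
  proof (rule eq_matI)
    fix i j assume "i < dim_row (- ?M)" "j < dim_col (- ?M)"
    then have "i < m + n" "j < m + n" using B C by auto
    then show "transpose_mat ?M $$ (i, j) = (- ?M) $$ (i, j)"
      using B C C'[of "i - m" "j - m"] by auto
  qed (use B C in auto)
  then show ?thesis
    using B C dC by (auto simp: skew_symmetric_def)
qed

lemma Pf_schur_complement:
  fixes B C E :: "'k::field mat"
  assumes B: "B \<in> carrier_mat m n" and C: "C \<in> carrier_mat n n" "skew_symmetric C"
    and E: "E \<in> carrier_mat n n" and CE: "C * E = 1\<^sub>m n" and EC: "E * C = 1\<^sub>m n"
    and ev: "even m" "even n"
  shows "Pf (four_block_mat (0\<^sub>m m m) B (- transpose_mat B) C) = Pf (B * E * transpose_mat B) * Pf C"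
proof -
  \<comment> \<open>Chosen so that \<open>X * C = - B\<close>, which clears the upper right block.
    As \<open>E\<close> is skew-symmetric, the transpose of \<open>X\<close> is
    \<open>E * transpose_mat B\<close>, which clears the lower left one.\<close>
  define X where "X = - (B * E)"
  have X: "X \<in> carrier_mat m n" using B E by (simp add: X_def)
  let ?M = "four_block_mat (0\<^sub>m m m) B (- transpose_mat B) C"
  let ?P = "four_block_mat (1\<^sub>m m) X (0\<^sub>m n m) (1\<^sub>m n)"
  have M: "?M \<in> carrier_mat (m + n) (m + n)" and P: "?P \<in> carrier_mat (m + n) (m + n)"
    using B C X by auto
  have tE: "transpose_mat E = - E"
    using skew_symmetric_inverse[OF C E CE EC] by (simp add: skew_symmetric_def)
  have XC: "X * C = - B"
  proof -
    have "X * C = - (B * E * C)" unfolding X_def using B C E by (simp add: uminus_mult_left_mat)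
    also have "B * E * C = B" using B C E EC by simp
    finally show ?thesis .
  qed
  have tX: "transpose_mat X = E * transpose_mat B"
  proof -
    have "transpose_mat X = - transpose_mat (B * E)" unfolding X_def by (rule eq_matI) auto
    also have "transpose_mat (B * E) = - (E * transpose_mat B)"
      unfolding transpose_mult[OF B E] tE using B E by (simp add: uminus_mult_left_mat)
    finally show ?thesis by simp
  qed
  have PM: "?P * ?M = four_block_mat (B * E * transpose_mat B) (0\<^sub>m m n) (- transpose_mat B) C"
  proof -
    have "?P * ?M = four_block_mat (1\<^sub>m m * 0\<^sub>m m m + X * - transpose_mat B) (1\<^sub>m m * B + X * C)
        (0\<^sub>m n m * 0\<^sub>m m m + 1\<^sub>m n * - transpose_mat B) (0\<^sub>m n m * B + 1\<^sub>m n * C)"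
      by (rule mult_four_block_mat) (use B C X in auto)
    also have "1\<^sub>m m * 0\<^sub>m m m + X * - transpose_mat B = B * E * transpose_mat B"
      using B E by (simp add: X_def uminus_mult_left_mat uminus_mult_right_mat)
    also have "1\<^sub>m m * B + X * C = 0\<^sub>m m n"
      unfolding XC using B by (intro eq_matI) auto
    finally show ?thesis using B C by simp
  qed
  have tP: "transpose_mat ?P = four_block_mat (1\<^sub>m m) (0\<^sub>m m n) (E * transpose_mat B) (1\<^sub>m n)"
    using X tX by (subst transpose_four_block_mat) auto
  have PMP: "?P * ?M * transpose_mat ?P = four_block_mat (B * E * transpose_mat B) (0\<^sub>m m n) (0\<^sub>m n m) C"
  proof -
    have "?P * ?M * transpose_mat ?P = four_block_mat
        (B * E * transpose_mat B * 1\<^sub>m m + 0\<^sub>m m n * (E * transpose_mat B))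
        (B * E * transpose_mat B * 0\<^sub>m m n + 0\<^sub>m m n * 1\<^sub>m n)
        (- transpose_mat B * 1\<^sub>m m + C * (E * transpose_mat B))
        (- transpose_mat B * 0\<^sub>m m n + C * 1\<^sub>m n)"
      unfolding PM tP by (rule mult_four_block_mat) (use B C E in auto)
    also have "C * (E * transpose_mat B) = transpose_mat B"
      using assoc_mult_mat[of C n n E n "transpose_mat B" m] B C E CE by simp
    also have "- transpose_mat B * 1\<^sub>m m + transpose_mat B = 0\<^sub>m n m"
      using B by (intro eq_matI) auto
    finally show ?thesis using B C E by simp
  qed
  have "det ?P = 1"
    using det_four_block_mat_lower_left_zero[of "1\<^sub>m m" m X n "0\<^sub>m n m" "1\<^sub>m n"] X by simp
  then have "Pf ?M = Pf (?P * ?M * transpose_mat ?P)"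
    using Pf_congruence[OF M skew_symmetric_four_block[OF B C] P] ev by simp
  also have "\<dots> = Pf (B * E * transpose_mat B) * Pf C"
    unfolding PMP by (rule Pf_four_block_diag) (use B C E ev in auto)
  finally show ?thesis .
qed

section \<open>The antidiagonal matrix and its block Pfaffian\<close>

lemma J_mat_carrier [simp]: "J_mat n \<in> carrier_mat n n"
  by (simp add: J_mat_def)

lemma dim_J_mat [simp]: "dim_row (J_mat n) = n" "dim_col (J_mat n) = n"
  by (simp_all add: J_mat_def)

lemma transpose_J_mat [simp]: "transpose_mat (J_mat n) = J_mat n"
  by (rule eq_matI) (auto simp: J_mat_def add.commute)

lemma J_mat_mult_J_mat: "J_mat n * J_mat n = (1\<^sub>m n :: 'k::comm_ring_1 mat)"
proof (rule eq_matI)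
  fix i j assume "i < dim_row (1\<^sub>m n :: 'k mat)" "j < dim_col (1\<^sub>m n :: 'k mat)"
  then have ij: "i < n" "j < n" by auto
  have "(J_mat n * J_mat n :: 'k mat) $$ (i, j) =
      (\<Sum>k<n. (if i + k + 1 = n then 1 else 0) * (if k + j + 1 = n then 1 else 0))"
    using ij by (simp add: scalar_prod_def J_mat_def atLeast0LessThan)
  also have "\<dots> = (\<Sum>k<n. (if k = n - 1 - i then (if k + j + 1 = n then 1 else 0) else 0))"
    using ij by (intro sum.cong) auto
  also have "\<dots> = (1\<^sub>m n :: 'k mat) $$ (i, j)"
    using ij by (auto simp: sum.delta')
  finally show "(J_mat n * J_mat n :: 'k mat) $$ (i, j) = 1\<^sub>m n $$ (i, j)" .
qed auto

text \<open>Only the nested matching of \<open>i\<close> with \<open>2 * n - 1 - i\<close>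
  contributes. The induction grows a window of indices symmetric about the middle; each expansion is
  along a row of the upper half, so the entries of \<open>C\<close> never appear.\<close>

lemma Pf_four_block_J_mat:
  fixes C :: "'k::comm_ring_1 mat"
  assumes C: "C \<in> carrier_mat n n" and n: "even n"
  shows "Pf (four_block_mat (0\<^sub>m n n) (J_mat n) (- J_mat n) C) = 1"
proof -
  let ?M = "four_block_mat (0\<^sub>m n n) (J_mat n) (- J_mat n) C"
  let ?f = "\<lambda>i j. ?M $$ (i, j)"
  have f: "?f i j = (if i + j + 1 = 2 * n then 1 else 0)" if "i < n" "j < 2 * n" for i j
    using that C by (auto simp: J_mat_def)
  have "pf_list ?f [n - k..<n + k] = 1" if "k \<le> n" for k
    using that
  proof (induction k)
    case (Suc k)
    define i where "i = n - Suc k"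
    have i: "n - k = Suc i" "n = i + Suc k" using Suc.prems by (auto simp: i_def)
    let ?L = "[Suc i..<n + Suc k]"
    have len: "length ?L = Suc (2 * k)" using i by simp
    have nth: "?L ! j = Suc i + j" if "j < Suc (2 * k)" for j
      using that i by (intro nth_upt) simp
    have "[i..<n + Suc k] = i # ?L" using i by (simp add: upt_conv_Cons del: upt_Suc)
    then have "pf_list ?f [i..<n + Suc k] = (\<Sum>j<Suc (2 * k). (-1) ^ j * ?f i (?L ! j) * pf_list ?f (drop_nth j ?L))"
      by (simp only: pf_list.simps(2) len)
    \<comment> \<open>Within the window, row \<open>i\<close> has its only nonzero entry in the last
      column. That column is at the even position \<open>2 * k\<close>, so the sign is
      positive.\<close>
    also have "\<dots> = (\<Sum>j\<in>{2 * k}. (-1) ^ j * ?f i (?L ! j) * pf_list ?f (drop_nth j ?L))"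
    proof (rule sum.mono_neutral_right)
      show "\<forall>j\<in>{..<Suc (2 * k)} - {2 * k}. (-1) ^ j * ?f i (?L ! j) * pf_list ?f (drop_nth j ?L) = 0"
      proof
        fix j assume "j \<in> {..<Suc (2 * k)} - {2 * k}"
        then have j: "j < 2 * k" by auto
        then have "?f i (?L ! j) = 0"
          using i by (subst nth, simp, subst f) auto
        then show "(-1) ^ j * ?f i (?L ! j) * pf_list ?f (drop_nth j ?L) = 0" by simp
      qed
    qed auto
    also have "\<dots> = ?f i (?L ! (2 * k)) * pf_list ?f (drop_nth (2 * k) ?L)" by simp
    also have "?f i (?L ! (2 * k)) = 1"
      using i by (subst nth, simp, subst f) auto
    also have "drop_nth (2 * k) ?L = [Suc i..<n + k]"
      using i by (simp add: drop_nth_def)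
    also have "pf_list ?f [Suc i..<n + k] = 1"
      using Suc.IH Suc.prems unfolding i(1) by (simp only: Suc_leD)
    finally show ?case unfolding i_def by (simp only: mult_1)
  qed simp
  from this[of n] show ?thesis
    using C n by (subst Pf_conv_pf_list) (auto simp: mult_2)
qed

section \<open>The copfaffian matrix as a multiple of the inverse\<close>

lemma drop_nth_conv_filter:
  assumes "distinct xs" "j < length xs"
  shows "drop_nth j xs = filter (\<lambda>x. x \<noteq> xs ! j) xs"
proof -
  have xs: "xs = take j xs @ xs ! j # drop (Suc j) xs"
    using assms id_take_nth_drop by blast
  then have "distinct (take j xs @ xs ! j # drop (Suc j) xs)"
    using assms by simp
  then have "filter (\<lambda>x. x \<noteq> xs ! j) (take j xs) = take j xs"
      "filter (\<lambda>x. x \<noteq> xs ! j) (drop (Suc j) xs) = drop (Suc j) xs"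
    unfolding filter_id_conv by auto
  then show ?thesis
    by (subst (3) xs) (simp add: drop_nth_def)
qed

lemma nths_upt_conv_filter: "nths [0..<n] K = filter (\<lambda>k. k \<in> K) [0..<n]"
  by (induction n) (auto simp: nths_append)

text \<open>The analogue of the adjugate identity. Up to \<open>(-1) ^ j\<close>, entry
  \<open>(i, j)\<close> of the product is the Pfaffian on the index list with \<open>j\<close>
  deleted and \<open>i\<close> put in front. For \<open>i = j\<close> moving the index back gives
  \<open>Pf A\<close>; otherwise \<open>i\<close> occurs twice and the value is 0.\<close>

lemma mult_transpose_copfaffian_mat:
  fixes A :: "'k::comm_ring_1 mat"
  assumes A: "A \<in> carrier_mat n n" "skew_symmetric A" and n: "even n"
  shows "A * transpose_mat (copfaffian_mat A) = Pf A \<cdot>\<^sub>m 1\<^sub>m n"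
proof (rule eq_matI)
  fix i j assume "i < dim_row (Pf A \<cdot>\<^sub>m 1\<^sub>m n)" "j < dim_col (Pf A \<cdot>\<^sub>m 1\<^sub>m n)"
  then have ij: "i < n" "j < n" by auto
  let ?a = "mat_fun A" and ?L = "[0..<n]" and ?c = "copfaffian_mat A"
  note alt = alternating_mat_fun[OF A(2)]
  \<comment> \<open>One exponent serves both triangles: for \<open>k < j\<close> the minus sign
    below the diagonal has been absorbed, which removes 1 from the exponent.\<close>
  have c: "?c $$ (j, k) = (if j = k then 0 else (-1) ^ (j + (if k < j then k else Suc k)) *
      pf_list ?a (filter (\<lambda>l. l \<noteq> k) (drop_nth j ?L)))" if k: "k < n" for k
  proof (cases "j = k")
    case True
    then show ?thesis using A k by (simp add: copfaffian_mat_def)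
  next
    case False
    let ?K = "{..<n} - {j, k}"
    have "card ?K = n - 2" using ij k False by (subst card_Diff_subset) auto
    then have "Pf (submatrix A ?K ?K) = pf_list ?a (nths ?L ?K)"
      using A n by (subst Pf_submatrix) auto
    also have "nths ?L ?K = filter (\<lambda>l. l \<noteq> k) (drop_nth j ?L)"
      unfolding nths_upt_conv_filter using ij by (subst drop_nth_conv_filter) (auto intro!: filter_cong)
    finally have "Pf (submatrix A ?K ?K) = pf_list ?a (filter (\<lambda>l. l \<noteq> k) (drop_nth j ?L))" .
    moreover have "{..<n} - {k, j} = ?K" by auto
    ultimately show ?thesis
      using A ij k False by (auto simp: copfaffian_mat_def Let_def add.commute)
  qed
  have "pf_list ?a (i # drop_nth j ?L) = (\<Sum>k'<n - 1. (-1) ^ k' * ?a i (drop_nth j ?L ! k') * pf_list ?a (drop_nth k' (drop_nth j ?L)))"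
    using ij by (simp add: pf_list.simps(2) length_drop_nth)
  \<comment> \<open>Positions \<open>k'\<close> in the list without \<open>j\<close> are replaced by
    the indices \<open>k\<close> found there; beyond \<open>j\<close> the index exceeds the position
    by one.\<close>
  also have "\<dots> = (\<Sum>k\<in>{..<n} - {j}. (-1) ^ j * (?a i k * ?c $$ (j, k)))"
  proof (rule sum.reindex_bij_witness[of _ "\<lambda>k. if k < j then k else k - 1" "\<lambda>k'. if k' < j then k' else Suc k'"])
    fix k' assume "k' \<in> {..<n - 1}"
    then have k': "k' < n - 1" by simp
    let ?k = "if k' < j then k' else Suc k'"
    have nth: "drop_nth j ?L ! k' = ?k"
      using k' ij by (subst nth_drop_nth) auto
    have dist: "distinct (drop_nth j ?L)"
      using ij by (subst drop_nth_conv_filter) auto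
    have "drop_nth k' (drop_nth j ?L) = filter (\<lambda>l. l \<noteq> ?k) (drop_nth j ?L)"
      using drop_nth_conv_filter[OF dist, of k'] k' ij nth by (simp add: length_drop_nth)
    moreover have "?k < n" "j \<noteq> ?k" using k' by auto
    moreover have "(-1) ^ k' = (-1) ^ j * (-1) ^ (j + (if ?k < j then ?k else Suc ?k)) * (1::'k)"
      by (auto simp: power_add)
    ultimately show "(-1) ^ j * (?a i ?k * ?c $$ (j, ?k)) = (-1) ^ k' * ?a i (drop_nth j ?L ! k') * pf_list ?a (drop_nth k' (drop_nth j ?L))"
      unfolding nth by (simp only: c if_False) (simp add: mult_ac)
  qed (use ij in auto)
  also have "\<dots> = (-1) ^ j * (\<Sum>k<n. ?a i k * ?c $$ (j, k))"
    unfolding sum_distrib_left using ij c[of j] by (intro sum.mono_neutral_left) auto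
  also have "(\<Sum>k<n. ?a i k * ?c $$ (j, k)) = (A * transpose_mat ?c) $$ (i, j)"
    using A ij by (auto simp: scalar_prod_def mat_fun_def copfaffian_mat_def Let_def atLeast0LessThan intro!: sum.cong)
  finally have exp: "(A * transpose_mat ?c) $$ (i, j) = (-1) ^ j * pf_list ?a (i # drop_nth j ?L)"
    by simp
  show "(A * transpose_mat ?c) $$ (i, j) = (Pf A \<cdot>\<^sub>m 1\<^sub>m n) $$ (i, j)"
  proof (cases "i = j")
    case True
    have L: "?L = take j ?L @ j # drop (Suc j) ?L"
      using id_take_nth_drop[of j ?L] ij by simp
    have "pf_list ?a (j # drop_nth j ?L) = (-1) ^ j * pf_list ?a ?L"
      unfolding drop_nth_def using pf_list_move_to_front[OF alt, of j "take j ?L" "drop (Suc j) ?L"] L ij by simp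
    then show ?thesis
      using True exp ij Pf_conv_pf_list_mat_fun[of A] A n by simp
  next
    case False
    then have "i \<in> set (drop_nth j ?L)"
      using ij by (subst drop_nth_conv_filter) auto
    then have "pf_list ?a (i # drop_nth j ?L) = 0"
      by (intro pf_list_not_distinct[OF alt]) simp
    then show ?thesis using exp False ij by simp
  qed
qed (use A in \<open>auto simp: copfaffian_mat_def Let_def\<close>)

section \<open>The Lindstroem-Gessel-Viennot lemma\<close>

context acyclic_path_finite_digraph
begin

text \<open>A repeated vertex would give a closed walk, hence a cycle. Walks spliced from pieces of
  different paths are therefore paths again, as the exchange argument requires.\<close>

lemma mem_paths_iff: "p \<in> paths D u v \<longleftrightarrow> awalk u p v"
proof -
  have "distinct (awalk_verts u p)" if a: "awalk u p v"
  proof (rule ccontr)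
    assume "\<not> distinct (awalk_verts u p)"
    then obtain r w where "awalk w r w" "r \<noteq> []"
      using awalk_not_distinct_decomp[OF a] by auto
    then have "closed_w r" by (auto simp: closed_w_def)
    then show False
      using closed_w_imp_cycle acyclic by blast
  qed
  then show ?thesis
    by (auto simp: paths_def apath_def)
qed

lemma distinct_awalk_verts: "awalk u p v \<Longrightarrow> distinct (awalk_verts u p)"
  using mem_paths_iff[of p u v] by (simp add: paths_def apath_def)

text \<open>The cut is made before the first arc that leaves \<open>w\<close>. If \<open>w\<close>
  is the final vertex of a path, no arc leaves it and the prefix is the whole path.\<close>

definition prefix_to :: "'v \<Rightarrow> 'e list \<Rightarrow> 'e list" where
  "prefix_to w p = takeWhile (\<lambda>e. tail D e \<noteq> w) p"

definition suffix_from :: "'v \<Rightarrow> 'e list \<Rightarrow> 'e list" where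
  "suffix_from w p = dropWhile (\<lambda>e. tail D e \<noteq> w) p"

text \<open>Tails together with the final vertex: unlike \<open>awalk_verts\<close> this refers to
  the end of the walk, which an exchange of initial segments keeps, and it is additive in the
  arcs.\<close>

definition walk_verts :: "'e list \<Rightarrow> 'v \<Rightarrow> 'v multiset" where
  "walk_verts p v = image_mset (tail D) (mset p) + {#v#}"

lemma mset_awalk_verts: "awalk u p v \<Longrightarrow> mset (awalk_verts u p) = walk_verts p v"
  by (induction p arbitrary: u) (auto simp: walk_verts_def awalk_simps)

lemma set_mset_walk_verts: "awalk u p v \<Longrightarrow> set_mset (walk_verts p v) = set (awalk_verts u p)"
  by (metis mset_awalk_verts set_mset_mset)

lemma count_walk_verts: "awalk u p v \<Longrightarrow> count (walk_verts p v) w = of_bool (w \<in># walk_verts p v)"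
  using distinct_awalk_verts[of u p v] mset_awalk_verts[of u p v]
  by (metis distinct_count_atmost_1 of_bool_eq(1) of_bool_eq(2) set_mset_mset)

lemma awalk_split:
  assumes "awalk u p v" "w \<in># walk_verts p v"
  shows "awalk u (prefix_to w p) w \<and> awalk w (suffix_from w p) v"
  using assms
proof (induction p arbitrary: u)
  case Nil
  then show ?case by (auto simp: prefix_to_def suffix_from_def walk_verts_def awalk_simps)
next
  case (Cons e p)
  then show ?case
    by (auto simp: prefix_to_def suffix_from_def walk_verts_def awalk_simps)
qed

lemma prefix_append_suffix [simp]: "prefix_to w p @ suffix_from w p = p"
  by (simp add: prefix_to_def suffix_from_def)

text \<open>The second piece is empty or begins with an arc leaving \<open>w\<close>, so cutting a
  spliced path at \<open>w\<close> recovers its pieces. This makes the exchange an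
  involution.\<close>

lemma prefix_to_splice [simp]: "prefix_to w (prefix_to w p @ suffix_from w q) = prefix_to w p"
proof -
  have 1: "takeWhile (\<lambda>e. tail D e \<noteq> w) (suffix_from w q) = []"
    by (induction q) (auto simp: suffix_from_def)
  have "takeWhile (\<lambda>e. tail D e \<noteq> w) (prefix_to w p @ suffix_from w q) =
      prefix_to w p @ takeWhile (\<lambda>e. tail D e \<noteq> w) (suffix_from w q)"
    unfolding prefix_to_def by (rule takeWhile_append2) (auto dest: set_takeWhileD)
  then show ?thesis
    unfolding 1 prefix_to_def by simp
qed

lemma suffix_from_splice [simp]: "suffix_from w (prefix_to w p @ suffix_from w q) = suffix_from w q"
  using prefix_append_suffix[of w "prefix_to w p @ suffix_from w q"] unfolding prefix_to_splice by blast

lemma finite_n_paths: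
  "set u \<subseteq> verts D \<Longrightarrow> set v \<subseteq> verts D \<Longrightarrow> finite (n_paths D u v)"
  and sum_n_paths:
  "set u \<subseteq> verts D \<Longrightarrow> set v \<subseteq> verts D \<Longrightarrow> length u = length v \<Longrightarrow>
    (\<Sum>P\<in>n_paths D u v. \<Prod>p\<leftarrow>P. path_weight x p) = (\<Prod>i<length v. path_sum D x (u ! i) (v ! i))"
proof (induction u v rule: list_induct2')
  case (4 a u b v)
  case 1
  have eq: "n_paths D (a # u) (b # v) = (\<lambda>(p, P). p # P) ` (paths D a b \<times> n_paths D u v)"
  proof (intro equalityI subsetI)
    fix Q assume "Q \<in> n_paths D (a # u) (b # v)"
    then show "Q \<in> (\<lambda>(p, P). p # P) ` (paths D a b \<times> n_paths D u v)"
      by (cases Q) (auto simp: n_paths_def All_less_Suc2)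
  qed (auto simp: n_paths_def All_less_Suc2)
  show ?case
    unfolding eq using 1 4 finite_paths by auto
  case 2
  have inj: "inj_on (\<lambda>(p, P). p # P) (paths D a b \<times> n_paths D u v)"
    by (auto intro: inj_onI)
  have "(\<Sum>P\<in>n_paths D (a # u) (b # v). \<Prod>p\<leftarrow>P. path_weight x p) =
      (\<Sum>(p, P)\<in>paths D a b \<times> n_paths D u v. path_weight x p * (\<Prod>p\<leftarrow>P. path_weight x p))"
    unfolding eq by (subst sum.reindex[OF inj]) (auto intro!: sum.cong)
  also have "\<dots> = path_sum D x a b * (\<Sum>P\<in>n_paths D u v. \<Prod>p\<leftarrow>P. path_weight x p)"
    by (simp add: path_sum_def sum_product sum.cartesian_product)
  also have "\<dots> = (\<Prod>i<length (b # v). path_sum D x ((a # u) ! i) ((b # v) ! i))"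
    using 4 2 by (simp add: prod.lessThan_Suc_shift del: prod.lessThan_Suc)
  finally show ?case .
qed (auto simp: n_paths_def cong: conj_cong)

end

section \<open>The sign-reversing exchange of initial segments\<close>

lemma sum_exchange_two:
  fixes f g :: "nat \<Rightarrow> 'k::comm_monoid_add"
  assumes "i < n" "j < n" "i \<noteq> j" "f i + f j = g i + g j" "\<And>k. k < n \<Longrightarrow> k \<noteq> i \<Longrightarrow> k \<noteq> j \<Longrightarrow> f k = g k"
  shows "(\<Sum>k<n. f k) = (\<Sum>k<n. g k)"
proof -
  have split: "(\<Sum>k<n. h k) = (h i + h j) + (\<Sum>k\<in>{..<n} - {i} - {j}. h k)" for h :: "nat \<Rightarrow> 'k"
    using assms by (simp add: sum.remove[of _ i] sum.remove[of _ j] add.assoc)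
  have "(\<Sum>k\<in>{..<n} - {i} - {j}. f k) = (\<Sum>k\<in>{..<n} - {i} - {j}. g k)"
    using assms(5) by (intro sum.cong) auto
  then show ?thesis unfolding split[of f] split[of g] assms(4) by simp
qed

lemma prod_exchange_two:
  fixes f g :: "nat \<Rightarrow> 'k::comm_monoid_mult"
  assumes "i < n" "j < n" "i \<noteq> j" "f i * f j = g i * g j" "\<And>k. k < n \<Longrightarrow> k \<noteq> i \<Longrightarrow> k \<noteq> j \<Longrightarrow> f k = g k"
  shows "(\<Prod>k<n. f k) = (\<Prod>k<n. g k)"
proof -
  have split: "(\<Prod>k<n. h k) = (h i * h j) * (\<Prod>k\<in>{..<n} - {i} - {j}. h k)" for h :: "nat \<Rightarrow> 'k"
    using assms by (simp add: prod.remove[of _ i] prod.remove[of _ j] mult.assoc)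
  have "(\<Prod>k\<in>{..<n} - {i} - {j}. f k) = (\<Prod>k\<in>{..<n} - {i} - {j}. g k)"
    using assms(5) by (intro prod.cong) auto
  then show ?thesis unfolding split[of f] split[of g] assms(4) by simp
qed

text \<open>The involution maps the elements of sign 1 onto those of sign -1, and the two partial
  sums cancel. Showing only that the sum equals its own negative would not suffice in characteristic
  2.\<close>

lemma sum_sign_reversing_involution:
  fixes f :: "'a \<Rightarrow> 'k::comm_ring_1" and s :: "'a \<Rightarrow> int"
  assumes "finite B" "\<And>b. b \<in> B \<Longrightarrow> \<iota> b \<in> B" "\<And>b. b \<in> B \<Longrightarrow> \<iota> (\<iota> b) = b"
    and "\<And>b. b \<in> B \<Longrightarrow> s b = 1 \<or> s b = -1" "\<And>b. b \<in> B \<Longrightarrow> s (\<iota> b) = - s b" "\<And>b. b \<in> B \<Longrightarrow> f (\<iota> b) = f b"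
  shows "(\<Sum>b\<in>B. of_int (s b) * f b) = 0"
proof -
  let ?E = "{b \<in> B. s b = 1}" and ?O = "{b \<in> B. s b = -1}"
  have "B = ?E \<union> ?O" using assms(4) by auto
  then have "(\<Sum>b\<in>B. of_int (s b) * f b) = (\<Sum>b\<in>?E \<union> ?O. of_int (s b) * f b)" by simp
  also have "\<dots> = (\<Sum>b\<in>?E. of_int (s b) * f b) + (\<Sum>b\<in>?O. of_int (s b) * f b)"
    by (rule sum.union_disjoint) (use assms(1) in auto)
  also have "(\<Sum>b\<in>?E. of_int (s b) * f b) = (\<Sum>b\<in>?E. f b)" by (rule sum.cong) auto
  also have "(\<Sum>b\<in>?O. of_int (s b) * f b) = (\<Sum>b\<in>?O. - f b)" by (rule sum.cong) auto
  also have "\<dots> = (\<Sum>b\<in>?E. - f b)"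
    by (rule sum.reindex_bij_witness[of _ \<iota> \<iota>]) (use assms in auto)
  finally show ?thesis by (simp add: sum_negf)
qed

context acyclic_path_finite_digraph
begin

context
  fixes v :: "'v list" and n :: nat
  assumes len_v: "length v = n"
begin

definition meets :: "'e list list \<Rightarrow> nat \<Rightarrow> 'v \<Rightarrow> bool" where
  "meets P k w \<longleftrightarrow> w \<in># walk_verts (P ! k) (v ! k)"

definition all_verts :: "'e list list \<Rightarrow> 'v multiset" where
  "all_verts P = (\<Sum>k<n. walk_verts (P ! k) (v ! k))"

text \<open>
  The vertex and the pair of paths at which the initial segments are exchanged depend only
  on data that the exchange preserves, namely on \<open>all_verts\<close> and on the set of paths through the
  vertex. Hence any
  choice makes the exchange an involution.
\<close>

definition sel_vert :: "'e list list \<Rightarrow> 'v" where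
  "sel_vert P = (SOME w. 2 \<le> count (all_verts P) w)"

definition sel_pair :: "'e list list \<Rightarrow> nat \<times> nat" where
  "sel_pair P = (SOME (i, j). i < n \<and> j < n \<and> i \<noteq> j \<and> meets P i (sel_vert P) \<and> meets P j (sel_vert P))"

text \<open>Initial segments are exchanged because permutations act on the starting vertices: path
  \<open>k\<close> of a configuration always ends in \<open>v ! k\<close>.\<close>

definition head_swap :: "'v \<Rightarrow> nat \<Rightarrow> nat \<Rightarrow> 'e list list \<Rightarrow> 'e list list" where
  "head_swap w i j P = P[i := prefix_to w (P ! j) @ suffix_from w (P ! i),
                         j := prefix_to w (P ! i) @ suffix_from w (P ! j)]"

definition swap_config :: "(nat \<Rightarrow> nat) \<times> 'e list list \<Rightarrow> (nat \<Rightarrow> nat) \<times> 'e list list" where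
  "swap_config = (\<lambda>(\<pi>, P). case sel_pair P of (i, j) \<Rightarrow> (\<pi> \<circ> transpose i j, head_swap (sel_vert P) i j P))"

context
  fixes u :: "'v list"
  assumes len_u: "length u = n"
begin

definition config :: "((nat \<Rightarrow> nat) \<times> 'e list list) set" where
  "config = {(\<pi>, P). \<pi> permutes {..<n} \<and> P \<in> n_paths D (permute_list \<pi> u) v}"

definition bad_config :: "((nat \<Rightarrow> nat) \<times> 'e list list) set" where
  "bad_config = {(\<pi>, P) \<in> config. \<not> non_intersecting D (permute_list \<pi> u) P}"

lemma config_iff: "(\<pi>, P) \<in> config \<longleftrightarrow>
    \<pi> permutes {..<n} \<and> length P = n \<and> (\<forall>i<n. awalk (u ! \<pi> i) (P ! i) (v ! i))"
  using len_u len_v by (auto simp: config_def n_paths_def mem_paths_iff permute_list_nth)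

lemma bad_config_iff: "(\<pi>, P) \<in> bad_config \<longleftrightarrow>
    (\<pi>, P) \<in> config \<and> (\<exists>i j w. i < n \<and> j < n \<and> i \<noteq> j \<and> meets P i w \<and> meets P j w)"
proof (cases "(\<pi>, P) \<in> config")
  case True
  then have *: "\<pi> permutes {..<n}" "length P = n" "\<And>i. i < n \<Longrightarrow> awalk (u ! \<pi> i) (P ! i) (v ! i)"
    by (auto simp: config_iff)
  then have "path_verts D (permute_list \<pi> u ! i) (P ! i) = {w. meets P i w}" if "i < n" for i
    using that set_mset_walk_verts[OF *(3)[OF that]] *(1)
    by (simp add: path_verts_def permute_list_nth len_u meets_def)
  then have "non_intersecting D (permute_list \<pi> u) P \<longleftrightarrow>
      (\<forall>i<n. \<forall>j<n. i \<noteq> j \<longrightarrow> {w. meets P i w} \<inter> {w. meets P j w} = {})"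
    unfolding non_intersecting_def *(2) by simp
  then show ?thesis
    using True by (auto simp: bad_config_def)
qed (auto simp: bad_config_def)

lemma count_all_verts:
  assumes "(\<pi>, P) \<in> config"
  shows "count (all_verts P) w = card {k. k < n \<and> meets P k w}"
proof -
  have "count (all_verts P) w = (\<Sum>k<n. of_bool (meets P k w))"
    unfolding all_verts_def count_sum
  proof (rule sum.cong[OF refl])
    fix k assume "k \<in> {..<n}"
    then show "count (walk_verts (P ! k) (v ! k)) w = of_bool (meets P k w)"
      using assms count_walk_verts[of "u ! \<pi> k" "P ! k" "v ! k" w] by (simp add: config_iff meets_def)
  qed
  also have "\<dots> = card {k. k < n \<and> meets P k w}"
    by (simp add: sum.If_cases of_bool_def Int_def)
  finally show ?thesis .
qed

text \<open>The choices are legitimate: each path visits a vertex at most once, so multiplicity at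
  least 2 in \<open>all_verts P\<close> means that two different paths meet there.\<close>

lemma bad_config_sel:
  assumes "(\<pi>, P) \<in> bad_config"
  obtains i j where "sel_pair P = (i, j)" "i < n" "j < n" "i \<noteq> j"
    "meets P i (sel_vert P)" "meets P j (sel_vert P)"
proof -
  have c: "(\<pi>, P) \<in> config" using assms by (simp add: bad_config_iff)
  have iff: "2 \<le> count (all_verts P) w \<longleftrightarrow> (\<exists>i j. i < n \<and> j < n \<and> i \<noteq> j \<and> meets P i w \<and> meets P j w)" for w
  proof -
    have "finite {k. k < n \<and> meets P k w}" by simp
    then have "2 \<le> card {k. k < n \<and> meets P k w} \<longleftrightarrow>
        (\<exists>i\<in>{k. k < n \<and> meets P k w}. \<exists>j\<in>{k. k < n \<and> meets P k w}. i \<noteq> j)"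
      using card_le_Suc0_iff_eq[of "{k. k < n \<and> meets P k w}"] by (auto simp: numeral_2_eq_2 not_le[symmetric] Suc_le_eq)
    then show ?thesis unfolding count_all_verts[OF c] by blast
  qed
  have "\<exists>w. 2 \<le> count (all_verts P) w"
    using assms unfolding iff bad_config_iff by blast
  then have "2 \<le> count (all_verts P) (sel_vert P)"
    unfolding sel_vert_def by (rule someI_ex)
  then have "\<exists>p. case p of (i, j) \<Rightarrow> i < n \<and> j < n \<and> i \<noteq> j \<and> meets P i (sel_vert P) \<and> meets P j (sel_vert P)"
    unfolding iff by auto
  then have "case sel_pair P of (i, j) \<Rightarrow> i < n \<and> j < n \<and> i \<noteq> j \<and> meets P i (sel_vert P) \<and> meets P j (sel_vert P)"
    unfolding sel_pair_def by (rule someI_ex)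
  then show thesis
    using that by (cases "sel_pair P") auto
qed

lemma swap_config:
  assumes b: "(\<pi>, P) \<in> bad_config" and eq: "swap_config (\<pi>, P) = (\<pi>', P')"
  shows "(\<pi>', P') \<in> bad_config" "swap_config (\<pi>', P') = (\<pi>, P)" "sign \<pi>' = - sign \<pi>"
    "(\<Prod>p\<leftarrow>P'. path_weight x p) = (\<Prod>p\<leftarrow>P. path_weight x p)"
proof -
  obtain i j where sel: "sel_pair P = (i, j)" and ij: "i < n" "j < n" "i \<noteq> j"
    and m: "meets P i (sel_vert P)" "meets P j (sel_vert P)"
    using b by (rule bad_config_sel)
  define w where "w = sel_vert P"
  have \<pi>': "\<pi>' = \<pi> \<circ> transpose i j" and P': "P' = head_swap w i j P"
    using eq by (auto simp: swap_config_def sel w_def)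
  have perm: "\<pi> permutes {..<n}" and len: "length P = n"
    and aw: "\<And>k. k < n \<Longrightarrow> awalk (u ! \<pi> k) (P ! k) (v ! k)"
    using b by (auto simp: bad_config_iff config_iff)
  have len': "length P' = n" using len by (simp add: P' head_swap_def)
  have P'i: "P' ! i = prefix_to w (P ! j) @ suffix_from w (P ! i)"
    and P'j: "P' ! j = prefix_to w (P ! i) @ suffix_from w (P ! j)"
    and P'k: "\<And>k. k \<noteq> i \<Longrightarrow> k \<noteq> j \<Longrightarrow> P' ! k = P ! k"
    using ij len by (auto simp: P' head_swap_def)
  have perm': "\<pi>' permutes {..<n}"
    unfolding \<pi>' using ij by (intro permutes_compose[OF _ perm] permutes_swap_id) auto
  have sp: "awalk (u ! \<pi> i) (prefix_to w (P ! i)) w" "awalk w (suffix_from w (P ! i)) (v ! i)"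
    "awalk (u ! \<pi> j) (prefix_to w (P ! j)) w" "awalk w (suffix_from w (P ! j)) (v ! j)"
    using awalk_split[OF aw[OF ij(1)]] awalk_split[OF aw[OF ij(2)]] m by (auto simp: meets_def w_def)
  have aw': "awalk (u ! \<pi>' k) (P' ! k) (v ! k)" if "k < n" for k
  proof (cases "k = i \<or> k = j")
    case True
    then show ?thesis
      using sp ij unfolding \<pi>' by (auto simp: P'i P'j intro: awalk_appendI simp del: awalk_append_iff)
  next
    case False
    then show ?thesis
      using aw[OF that] by (simp add: \<pi>' P'k transpose_apply_other)
  qed
  have c': "(\<pi>', P') \<in> config"
    using perm' len' aw' by (simp add: config_iff)
  have w_suffix: "w \<in># walk_verts (suffix_from w (P ! k)) (v ! k)" if "k = i \<or> k = j" for k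
    using that set_mset_walk_verts[OF sp(2)] set_mset_walk_verts[OF sp(4)]
      hd_in_awalk_verts(1)[OF sp(2)] hd_in_awalk_verts(1)[OF sp(4)] by auto
  have m': "meets P' i w" "meets P' j w"
    using w_suffix by (auto simp: meets_def P'i P'j walk_verts_def)
  show bad': "(\<pi>', P') \<in> bad_config"
    unfolding bad_config_iff using c' ij m' by blast
  have pi: "mset (P ! k) = mset (prefix_to w (P ! k)) + mset (suffix_from w (P ! k))" for k
    by (metis mset_append prefix_append_suffix)
  \<comment> \<open>The exchange redistributes arcs between two paths and keeps all final vertices.
    Hence \<open>sel_vert\<close> faces the same predicate before and after.\<close>
  have av: "all_verts P' = all_verts P"
    unfolding all_verts_def
  proof (rule sum_exchange_two[OF ij])
    show "walk_verts (P' ! i) (v ! i) + walk_verts (P' ! j) (v ! j) = walk_verts (P ! i) (v ! i) + walk_verts (P ! j) (v ! j)"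
      by (simp add: walk_verts_def P'i P'j pi[of i] pi[of j])
  qed (simp add: P'k)
  have sv: "sel_vert P' = w"
    unfolding w_def sel_vert_def av ..
  \<comment> \<open>Paths \<open>i\<close> and \<open>j\<close> pass through \<open>w\<close> before
    and after the exchange and the others are untouched, so \<open>sel_pair\<close> also repeats its
    choice.\<close>
  have mw: "meets P' k w \<longleftrightarrow> meets P k w" for k
    using m m' by (cases "k = i \<or> k = j") (auto simp: w_def meets_def P'k)
  have sel': "sel_pair P' = (i, j)"
    unfolding sel[symmetric] sel_pair_def sv w_def[symmetric] mw ..
  have "head_swap w i j P' = P"
  proof (rule nth_equalityI)
    fix k assume "k < length (head_swap w i j P')"
    then show "head_swap w i j P' ! k = P ! k"
      using ij len' by (cases "k = i \<or> k = j") (auto simp: head_swap_def P'i P'j P'k)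
  qed (simp add: head_swap_def len len')
  moreover have "\<pi>' \<circ> transpose i j = \<pi>"
    unfolding \<pi>' by (auto simp: fun_eq_iff)
  ultimately show "swap_config (\<pi>', P') = (\<pi>, P)"
    by (simp add: swap_config_def sel' sv)
  show "sign \<pi>' = - sign \<pi>"
    unfolding \<pi>' using permutes_imp_permutation[OF _ perm] ij(3)
    by (simp add: sign_compose permutation_swap_id sign_swap_id del: o_apply)
  have pw: "path_weight x (p @ q) = path_weight x p * path_weight x q" for p q
    by (simp add: path_weight_def)
  have pw2: "path_weight x (P ! k) = path_weight x (prefix_to w (P ! k)) * path_weight x (suffix_from w (P ! k))" for k
    by (metis pw prefix_append_suffix)
  have "(\<Prod>k<n. path_weight x (P' ! k)) = (\<Prod>k<n. path_weight x (P ! k))"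
  proof (rule prod_exchange_two[OF ij])
    show "path_weight x (P' ! i) * path_weight x (P' ! j) = path_weight x (P ! i) * path_weight x (P ! j)"
      unfolding P'i P'j pw pw2[of i] pw2[of j] by (simp only: mult_ac)
  qed (simp add: P'k)
  then show "(\<Prod>p\<leftarrow>P'. path_weight x p) = (\<Prod>p\<leftarrow>P. path_weight x p)"
    using len len' by (simp add: prod.list_conv_set_nth atLeast0LessThan)
qed

end
end

theorem lindstroem_gessel_viennot:
  fixes x :: "'e \<Rightarrow> 'k::comm_ring_1"
  assumes u: "set u \<subseteq> verts D" and v: "set v \<subseteq> verts D" and len: "length u = n" "length v = n"
  shows "(\<Sum>\<pi> | \<pi> permutes {..<n}. of_int (sign \<pi>) * F0 D x (permute_list \<pi> u) v) =
    det (mat n n (\<lambda>(i, j). path_sum D x (u ! i) (v ! j)))"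
proof -
  let ?wt = "\<lambda>P. \<Prod>p\<leftarrow>P. path_weight x p"
  let ?S = "{\<pi>. \<pi> permutes {..<n}}"
  let ?bad = "\<lambda>\<pi>. {P \<in> n_paths D (permute_list \<pi> u) v. \<not> non_intersecting D (permute_list \<pi> u) P}"
  note bc = bad_config_def[OF len(2,1)] config_def[OF len(2,1)]
  have finS: "finite ?S" by (rule finite_permutations) simp
  have fin: "finite (n_paths D (permute_list \<pi> u) v)" if "\<pi> permutes {..<n}" for \<pi>
    using that u v len by (intro finite_n_paths) auto
  have Bad: "bad_config v n u = Sigma ?S ?bad"
    by (auto simp: bc)
  have "(\<Sum>\<pi>\<in>?S. of_int (sign \<pi>) * (\<Sum>P\<in>?bad \<pi>. ?wt P)) = (\<Sum>(\<pi>, P)\<in>bad_config v n u. of_int (sign \<pi>) * ?wt P)"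
    unfolding Bad sum_distrib_left by (rule sum.Sigma) (use finS fin in auto)
  also have "\<dots> = (\<Sum>b\<in>bad_config v n u. of_int (sign (fst b)) * ?wt (snd b))"
    by (simp add: case_prod_beta)
  also have "\<dots> = 0"
  proof (rule sum_sign_reversing_involution[where \<iota> = "swap_config v n"])
    show "finite (bad_config v n u)"
      unfolding Bad using finS fin by (intro finite_SigmaI) auto
    fix b assume b: "b \<in> bad_config v n u"
    obtain \<pi> P \<pi>' P' where bb: "b = (\<pi>, P)" "swap_config v n b = (\<pi>', P')"
      by (metis surj_pair)
    note sc = swap_config[OF len(2,1) b[unfolded bb(1)] bb(2)[unfolded bb(1)]]
    show "swap_config v n b \<in> bad_config v n u" "swap_config v n (swap_config v n b) = b"
      "sign (fst (swap_config v n b)) = - sign (fst b)" "?wt (snd (swap_config v n b)) = ?wt (snd b)"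
      unfolding bb(2) using sc by (simp_all add: bb(1))
    show "sign (fst b) = 1 \<or> sign (fst b) = - 1"
      by (simp add: sign_def)
  qed
  finally have cancel: "(\<Sum>\<pi>\<in>?S. of_int (sign \<pi>) * (\<Sum>P\<in>?bad \<pi>. ?wt P)) = 0" .
  have "det (mat n n (\<lambda>(i, j). path_sum D x (u ! i) (v ! j))) =
      (\<Sum>\<pi>\<in>?S. of_int (sign \<pi>) * (\<Prod>j<n. path_sum D x (u ! \<pi> j) (v ! j)))"
  proof -
    \<comment> \<open>The column form of the Leibniz formula permutes row indices, in agreement with
      the permuted starting vertices.\<close>
    have "det (mat n n (\<lambda>(i, j). path_sum D x (u ! i) (v ! j))) =
        (\<Sum>\<pi> | \<pi> permutes {0..<n}. signof \<pi> * (\<Prod>j<n. mat n n (\<lambda>(i, j). path_sum D x (u ! i) (v ! j)) $$ (\<pi> j, j)))"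
      by (rule det_col) simp
    also have "\<dots> = (\<Sum>\<pi>\<in>?S. of_int (sign \<pi>) * (\<Prod>j<n. path_sum D x (u ! \<pi> j) (v ! j)))"
      unfolding atLeast0LessThan
    proof (intro sum.cong refl arg_cong2[of _ _ _ _ "(*)"] prod.cong)
      fix p i assume "p \<in> ?S" "i \<in> {..<n}"
      then have "i < n" "p i < n"
        using permutes_in_image[of p "{..<n}" i] by auto
      then show "mat n n (\<lambda>(i, j). path_sum D x (u ! i) (v ! j)) $$ (p i, i) = path_sum D x (u ! p i) (v ! i)" by simp
    qed
    finally show ?thesis .
  qed
  also have "\<dots> = (\<Sum>\<pi>\<in>?S. of_int (sign \<pi>) * (\<Sum>P\<in>n_paths D (permute_list \<pi> u) v. ?wt P))"
  proof (intro sum.cong refl arg_cong2[of _ _ _ _ "(*)"])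
    fix \<pi> assume "\<pi> \<in> ?S"
    then have p: "\<pi> permutes {..<length u}" using len by simp
    have "(\<Sum>P\<in>n_paths D (permute_list \<pi> u) v. ?wt P) = (\<Prod>i<length v. path_sum D x (permute_list \<pi> u ! i) (v ! i))"
      by (rule sum_n_paths) (use u v len p in auto)
    also have "\<dots> = (\<Prod>j<n. path_sum D x (u ! \<pi> j) (v ! j))"
      using len by (intro prod.cong) (auto simp: permute_list_nth[OF p])
    finally show "(\<Prod>j<n. path_sum D x (u ! \<pi> j) (v ! j)) = (\<Sum>P\<in>n_paths D (permute_list \<pi> u) v. ?wt P)" ..
  qed
  also have "\<dots> = (\<Sum>\<pi>\<in>?S. of_int (sign \<pi>) * F0 D x (permute_list \<pi> u) v + of_int (sign \<pi>) * (\<Sum>P\<in>?bad \<pi>. ?wt P))"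
  proof (rule sum.cong[OF refl])
    fix \<pi> assume "\<pi> \<in> ?S"
    then have "finite (n_paths D (permute_list \<pi> u) v)" using fin by simp
    then have "(\<Sum>P\<in>n_paths D (permute_list \<pi> u) v. ?wt P) = F0 D x (permute_list \<pi> u) v + (\<Sum>P\<in>?bad \<pi>. ?wt P)"
      unfolding F0_def by (subst sum.union_disjoint[symmetric]) (auto intro!: sum.cong)
    then show "of_int (sign \<pi>) * (\<Sum>P\<in>n_paths D (permute_list \<pi> u) v. ?wt P) =
        of_int (sign \<pi>) * F0 D x (permute_list \<pi> u) v + of_int (sign \<pi>) * (\<Sum>P\<in>?bad \<pi>. ?wt P)"
      by (simp add: distrib_left)
  qed
  also have "\<dots> = (\<Sum>\<pi>\<in>?S. of_int (sign \<pi>) * F0 D x (permute_list \<pi> u) v)"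
    unfolding sum.distrib cancel by simp
  finally show ?thesis by simp
qed

end

section \<open>Summation over subsets of the endpoints\<close>

lemma Pf_block_copfaffian_mat:
  fixes A H :: "'k::field mat"
  assumes A: "A \<in> carrier_mat n n" "skew_symmetric A" "invertible_mat A"
    and H: "H \<in> carrier_mat m n" and ev: "even m" "even n"
  shows "Pf A * Pf (four_block_mat (0\<^sub>m m m) (H * J_mat n) (- J_mat n * transpose_mat H)
      ((1 / Pf A) \<cdot>\<^sub>m (J_mat n * transpose_mat (copfaffian_mat A) * J_mat n))) =
    Pf (H * A * transpose_mat H)"
proof -
  let ?J = "J_mat n :: 'k mat"
  obtain B where B: "B \<in> carrier_mat n n" and AB: "A * B = 1\<^sub>m n" and BA: "B * A = 1\<^sub>m n"
  proof -
    obtain B where "inverts_mat A B" "inverts_mat B A"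
      using A(3) by (auto simp: invertible_mat_def)
    then have AB: "A * B = 1\<^sub>m n" and BA: "B * A = 1\<^sub>m (dim_row B)"
      using A(1) by (auto simp: inverts_mat_def)
    have "dim_col B = n" using arg_cong[OF AB, of dim_col] by simp
    moreover have "dim_row B = n" using arg_cong[OF BA, of dim_col] A(1) by simp
    ultimately show thesis using that AB BA by auto
  qed
  have J: "?J \<in> carrier_mat n n" by simp
  have JJ: "?J * (?J * X) = X" if "X \<in> carrier_mat n k" for X k
    by (subst assoc_mult_mat[OF J J that, symmetric]) (simp only: J_mat_mult_J_mat left_mult_one_mat[OF that])
  \<comment> \<open>\<open>C\<close> will turn out to be the lower right block and \<open>E\<close>
    is its inverse, since \<open>J\<close> squares to 1. For the same reason the factors
    \<open>J\<close> cancel in \<open>H * J * E * transpose_mat (H * J)\<close>.\<close>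
  define C where "C = ?J * B * ?J"
  define E where "E = ?J * A * ?J"
  have C: "C \<in> carrier_mat n n" and E: "E \<in> carrier_mat n n"
    unfolding C_def E_def using mult_carrier_mat[OF mult_carrier_mat[OF J B] J]
      mult_carrier_mat[OF mult_carrier_mat[OF J A(1)] J] by blast+
  have skewC: "skew_symmetric C"
    unfolding C_def using skew_symmetric_congruence[OF B skew_symmetric_inverse[OF A(1,2) B AB BA] J] by simp
  have conj_mult: "?J * X * ?J * (?J * Y * ?J) = ?J * (X * Y) * ?J"
    if X: "X \<in> carrier_mat n n" and Y: "Y \<in> carrier_mat n n" for X Y
  proof -
    have "?J * X * ?J * (?J * Y * ?J) = ?J * (X * (?J * (?J * (Y * ?J))))"
      using X Y by (simp add: assoc_mult_mat[of _ n n _ n _ n] mult_carrier_mat[of _ n n _ n])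
    also have "\<dots> = ?J * (X * Y) * ?J"
      using X Y by (simp add: JJ[of _ n] assoc_mult_mat[of _ n n _ n _ n] mult_carrier_mat[of _ n n _ n])
    finally show ?thesis .
  qed
  have CE: "C * E = 1\<^sub>m n" and EC: "E * C = 1\<^sub>m n"
    unfolding C_def E_def conj_mult[OF B A(1)] conj_mult[OF A(1) B] AB BA
    using J_mat_mult_J_mat[of n] by simp_all
  have conj_J: "X * ?J * E * transpose_mat (X * ?J) = X * A * transpose_mat X" if X: "X \<in> carrier_mat k n" for X k
  proof -
    have t: "transpose_mat (X * ?J) = ?J * transpose_mat X"
      using transpose_mult[OF X J] by simp
    have "X * ?J * E * transpose_mat (X * ?J) = X * (?J * (?J * (A * (?J * (?J * transpose_mat X)))))"
      unfolding t E_def using X A(1)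
      by (simp add: assoc_mult_mat[of _ k n _ n _ n] assoc_mult_mat[of _ k n _ n _ k] assoc_mult_mat[of _ n n _ n _ n] assoc_mult_mat[of _ n n _ n _ k]
          mult_carrier_mat[of _ n n _ n] mult_carrier_mat[of _ n n _ k] mult_carrier_mat[of _ k n _ n])
    also have "\<dots> = X * A * transpose_mat X"
      using X A(1) by (simp add: JJ[of _ k] assoc_mult_mat[of _ k n _ n _ k]
          mult_carrier_mat[of _ n n _ n] mult_carrier_mat[of _ n n _ k] mult_carrier_mat[of _ k n _ n])
    finally show ?thesis .
  qed
  \<comment> \<open>Evaluating the Pfaffian for \<open>H = 1\<close> in two ways shows that \<open>Pf A\<close> is invertible.\<close>
  have "Pf A * Pf C = 1"
  proof -
    have "Pf (four_block_mat (0\<^sub>m n n) ?J (- transpose_mat ?J) C) = Pf (?J * E * transpose_mat ?J) * Pf C"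
      by (rule Pf_schur_complement[OF J C skewC E CE EC ev(2) ev(2)])
    also have "?J * E * transpose_mat ?J = A"
      using conj_J[of "1\<^sub>m n" n] A(1) E by simp
    finally show ?thesis
      using Pf_four_block_J_mat[OF C ev(2)] by simp
  qed
  then have PfA: "Pf A \<noteq> 0" by auto
  have cop: "copfaffian_mat A \<in> carrier_mat n n"
    using A(1) by (simp add: copfaffian_mat_def Let_def)
  have "transpose_mat (copfaffian_mat A) = B * (A * transpose_mat (copfaffian_mat A))"
    using assoc_mult_mat[OF B A(1), of "transpose_mat (copfaffian_mat A)" n] BA cop by simp
  also have "\<dots> = Pf A \<cdot>\<^sub>m B"
    unfolding mult_transpose_copfaffian_mat[OF A(1,2) ev(2)]
    using B mult_smult_distrib[OF B one_carrier_mat[of n], of "Pf A"] by simp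
  finally have cop_B: "transpose_mat (copfaffian_mat A) = Pf A \<cdot>\<^sub>m B" .
  have "?J * transpose_mat (copfaffian_mat A) * ?J = Pf A \<cdot>\<^sub>m C"
    unfolding cop_B C_def mult_smult_distrib[OF J B]
    by (rule mult_smult_assoc_mat[OF mult_carrier_mat[OF J B] J])
  \<comment> \<open>Here \<open>Pf A \<noteq> 0\<close> is indispensable: division by zero yields 0
    and would make the block vanish.\<close>
  then have Ceq: "(1 / Pf A) \<cdot>\<^sub>m (?J * transpose_mat (copfaffian_mat A) * ?J) = C"
    using PfA C by (intro eq_matI) auto
  have HJ: "H * ?J \<in> carrier_mat m n" using H by simp
  have "- ?J * transpose_mat H = - transpose_mat (H * ?J)"
    using transpose_mult[OF H J] H by (simp add: uminus_mult_left_mat)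
  then have "Pf (four_block_mat (0\<^sub>m m m) (H * ?J) (- ?J * transpose_mat H)
      ((1 / Pf A) \<cdot>\<^sub>m (?J * transpose_mat (copfaffian_mat A) * ?J))) =
      Pf (H * A * transpose_mat H) * Pf C"
    unfolding Ceq using Pf_schur_complement[OF HJ C skewC E CE EC ev] conj_J[OF H] by simp
  then show ?thesis
    using \<open>Pf A * Pf C = 1\<close> by (simp add: mult.left_commute)
qed

text \<open>A permutation without inversions lists \<open>{..<m}\<close> in increasing order, and
  there is only one such list.\<close>

lemma permutes_inversion:
  fixes \<pi> :: "nat \<Rightarrow> nat"
  assumes "\<pi> permutes {..<m}" "\<pi> \<noteq> id"
  obtains i j where "i < j" "j < m" "\<pi> j < \<pi> i"
proof (rule ccontr)
  assume "\<not> thesis"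
  then have mono: "\<pi> i \<le> \<pi> j" if "i < j" "j < m" for i j
    using \<open>\<And>i j. i < j \<Longrightarrow> j < m \<Longrightarrow> \<pi> j < \<pi> i \<Longrightarrow> thesis\<close> that by (meson not_less)
  have "map \<pi> [0..<m] = [0..<m]"
  proof (rule sorted_distinct_set_unique)
    show "sorted (map \<pi> [0..<m])"
      unfolding sorted_iff_nth_mono_less using mono by auto
    show "distinct (map \<pi> [0..<m])"
      using permutes_inj_on[OF assms(1)] by (simp add: distinct_map)
    show "set (map \<pi> [0..<m]) = set [0..<m]"
      using permutes_image[OF assms(1)] by (simp add: atLeast0LessThan)
  qed auto
  then have "\<pi> i = i" if "i < m" for i
    using that by (simp add: list_eq_iff_nth_eq)
  then have "\<pi> = id"
    using permutes_not_in[OF assms(1)] by (auto simp: fun_eq_iff)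
  with assms(2) show False by blast
qed

section \<open>Vertex subsets as index subsets, and the compatible case\<close>

lemma index_set_nth_image:
  assumes "distinct S" "K \<subseteq> {..<length S}"
  shows "{i. i < length S \<and> S ! i \<in> (!) S ` K} = K"
  using assms by (auto simp: nth_eq_iff_index_eq subset_iff)

lemma bij_betw_nth_image:
  assumes "distinct S"
  shows "bij_betw (\<lambda>K. (!) S ` K) {K. K \<subseteq> {..<length S} \<and> card K = m} {I. I \<subseteq> set S \<and> card I = m}"
proof (rule bij_betw_byWitness[where f' = "\<lambda>I. {i. i < length S \<and> S ! i \<in> I}"])
  have inj: "inj_on ((!) S) K" if "K \<subseteq> {..<length S}" for K
    using assms that by (intro inj_on_nth) auto
  show "\<forall>K\<in>{K. K \<subseteq> {..<length S} \<and> card K = m}. {i. i < length S \<and> S ! i \<in> (!) S ` K} = K"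
    using index_set_nth_image[OF assms] by blast
  have im: "(!) S ` {i. i < length S \<and> S ! i \<in> I} = I" if "I \<subseteq> set S" for I
  proof (intro equalityI subsetI)
    fix x assume x: "x \<in> I"
    then obtain i where "i < length S" "x = S ! i"
      using \<open>I \<subseteq> set S\<close> by (metis in_set_conv_nth subsetD)
    with x show "x \<in> (!) S ` {i. i < length S \<and> S ! i \<in> I}" by blast
  qed auto
  then show "\<forall>I\<in>{I. I \<subseteq> set S \<and> card I = m}. (!) S ` {i. i < length S \<and> S ! i \<in> I} = I" by auto
  show "(\<lambda>K. (!) S ` K) ` {K. K \<subseteq> {..<length S} \<and> card K = m} \<subseteq> {I. I \<subseteq> set S \<and> card I = m}"
    using card_image[OF inj] by auto
  have "card {i. i < length S \<and> S ! i \<in> I} = card I" if "I \<subseteq> set S" for I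
  proof -
    have "{i. i < length S \<and> S ! i \<in> I} \<subseteq> {..<length S}" by auto
    from card_image[OF inj[OF this]] show ?thesis unfolding im[OF that] by simp
  qed
  then show "(\<lambda>I. {i. i < length S \<and> S ! i \<in> I}) ` {I. I \<subseteq> set S \<and> card I = m} \<subseteq> {K. K \<subseteq> {..<length S} \<and> card K = m}"
    by auto
qed

lemma subset_tuple_nth_image:
  assumes "distinct S" "K \<subseteq> {..<length S}"
  shows "subset_tuple S ((!) S ` K) = map (\<lambda>i. S ! pick K i) [0..<card K]"
proof -
  have "subset_tuple S ((!) S ` K) = nths S K"
    using filter_eq_nths[of "\<lambda>v. v \<in> (!) S ` K" S] index_set_nth_image[OF assms]
    by (simp add: subset_tuple_def)
  also have "\<dots> = map (\<lambda>i. S ! pick K i) [0..<card K]"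
  proof (rule nth_equalityI)
    have c: "{i. i < length S \<and> i \<in> K} = K" using assms by auto
    show "length (nths S K) = length (map (\<lambda>i. S ! pick K i) [0..<card K])"
      by (simp add: length_nths c)
    fix i assume "i < length (nths S K)"
    then show "nths S K ! i = map (\<lambda>i. S ! pick K i) [0..<card K] ! i"
      using nth_nths[of i S K] by (simp add: length_nths c)
  qed
  finally show ?thesis .
qed

text \<open>At an inversion \<open>i < j\<close>, \<open>\<pi> j < \<pi> i\<close>, the path
  starting at the earlier entry of \<open>u\<close> ends at the later vertex of \<open>S\<close>,
  and vice versa. By compatibility these two paths meet, so the sum defining \<open>F0\<close> is
  empty.\<close>

lemma F0_D_compatible_eq_0:
  assumes comp: "D_compatible D u S" and \<pi>: "\<pi> permutes {..<m}" "\<pi> \<noteq> id" and u: "length u = m"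
    and K: "K \<subseteq> {..<length S}" "card K = m"
  shows "F0 D x (permute_list \<pi> u) (map (\<lambda>i. S ! pick K i) [0..<m]) = 0"
proof -
  have False if P: "P \<in> n_paths D (permute_list \<pi> u) (map (\<lambda>i. S ! pick K i) [0..<m])"
    and ni: "non_intersecting D (permute_list \<pi> u) P" for P
  proof -
    obtain i j where ij: "i < j" "j < m" "\<pi> j < \<pi> i"
      using permutes_inversion[OF \<pi>] by blast
    have path: "P ! k \<in> paths D (u ! \<pi> k) (S ! pick K k)" if "k < m" for k
      using P that \<pi>(1) u by (auto simp: n_paths_def permute_list_nth)
    have len: "length P = m" using P u by (simp add: n_paths_def)
    have "\<pi> i < m" using permutes_in_image[OF \<pi>(1), of i] ij by simp
    moreover have "pick K i < pick K j"
      using pick_mono_le[of j K i] ij K by simp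
    moreover have "pick K j < length S"
      using pick_in_set_le[of j K] ij K by auto
    ultimately have "path_verts D (u ! \<pi> j) (P ! j) \<inter> path_verts D (u ! \<pi> i) (P ! i) \<noteq> {}"
      using comp ij u path[of i] path[of j] unfolding D_compatible_def by force
    moreover have "path_verts D (u ! \<pi> j) (P ! j) \<inter> path_verts D (u ! \<pi> i) (P ! i) = {}"
      using ni ij \<pi>(1) u len by (auto simp: non_intersecting_def permute_list_nth)
    ultimately show False by blast
  qed
  then have "{P \<in> n_paths D (permute_list \<pi> u) (map (\<lambda>i. S ! pick K i) [0..<m]).
      non_intersecting D (permute_list \<pi> u) P} = {}" by blast
  then show ?thesis unfolding F0_def by (simp only: sum.empty)
qed

theorem theorem4p3:
  fixes D :: "('v, 'e) pre_digraph"
    and x :: "'e \<Rightarrow> 'k::field"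
    and m N :: nat
    and u S :: "'v list"
    and A :: "'k mat"
  assumes "acyclic_path_finite_digraph D"
    and "even m" and "even N" and "m \<le> N"
    and "length u = m" and "set u \<subseteq> verts D"
    and "length S = N" and "distinct S" and "set S \<subseteq> verts D"
    and "A \<in> carrier_mat N N" and "skew_symmetric A" and "invertible_mat A"
  shows
    "(\<Sum>I\<in>{I. I \<subseteq> set S \<and> card I = m}. Pf (principal_submat A S I) *
        (\<Sum>\<pi>\<in>{\<pi>. \<pi> permutes {..<m}}.
          of_int (sign \<pi>) * F0 D x (permute_list \<pi> u) (subset_tuple S I))) =
      Pf A * Pf (four_block_mat
        (0\<^sub>m m m) (H_mat D x u S * J_mat N)
        (- J_mat N * transpose_mat (H_mat D x u S))
        ((1 / Pf A) \<cdot>\<^sub>m (J_mat N * transpose_mat (copfaffian_mat A) * J_mat N))) \<and>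
    (D_compatible D u S \<longrightarrow>
      (\<Sum>I\<in>{I. I \<subseteq> set S \<and> card I = m}. Pf (principal_submat A S I) *
          F0 D x u (subset_tuple S I)) =
      Pf A * Pf (four_block_mat
        (0\<^sub>m m m) (H_mat D x u S * J_mat N)
        (- J_mat N * transpose_mat (H_mat D x u S))
        ((1 / Pf A) \<cdot>\<^sub>m (J_mat N * transpose_mat (copfaffian_mat A) * J_mat N))))"
proof -
  interpret acyclic_path_finite_digraph D by fact
  let ?T = "{K. K \<subseteq> {..<N} \<and> card K = m}"
  let ?H = "H_mat D x u S"
  let ?S = "{I. I \<subseteq> set S \<and> card I = m}"
  let ?g = "\<lambda>I. Pf (principal_submat A S I) * (\<Sum>\<pi>\<in>{\<pi>. \<pi> permutes {..<m}}.
      of_int (sign \<pi>) * F0 D x (permute_list \<pi> u) (subset_tuple S I))"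
  let ?h = "\<lambda>I. Pf (principal_submat A S I) * F0 D x u (subset_tuple S I)"
  let ?rhs = "Pf A * Pf (four_block_mat (0\<^sub>m m m) (?H * J_mat N) (- J_mat N * transpose_mat ?H)
      ((1 / Pf A) \<cdot>\<^sub>m (J_mat N * transpose_mat (copfaffian_mat A) * J_mat N)))"
  let ?F = "\<lambda>K \<pi>. F0 D x (permute_list \<pi> u) (map (\<lambda>i. S ! pick K i) [0..<m])"
  have bij: "bij_betw (\<lambda>K. (!) S ` K) ?T ?S"
    using bij_betw_nth_image[OF assms(8), of m] assms(7) by simp
  have tuple: "subset_tuple S ((!) S ` K) = map (\<lambda>i. S ! pick K i) [0..<m]"
    and sub: "principal_submat A S ((!) S ` K) = submatrix A K K" if "K \<in> ?T" for K
    using that subset_tuple_nth_image[of S K] index_set_nth_image[of S K] assms(7,8)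
    by (auto simp: principal_submat_def)
  have H: "?H \<in> carrier_mat m N"
    using assms by (simp add: H_mat_def)
  have lgv: "(\<Sum>\<pi> | \<pi> permutes {..<m}. of_int (sign \<pi>) * ?F K \<pi>) =
      det (mat m m (\<lambda>(i, j). ?H $$ (i, pick K j)))" if "K \<in> ?T" for K
  proof -
    have pick: "pick K j < N" if "j < m" for j
      using pick_in_set_le[of j K] that \<open>K \<in> ?T\<close> by auto
    have "set (map (\<lambda>i. S ! pick K i) [0..<m]) \<subseteq> verts D"
      using pick assms(7,9) by (auto simp: subset_iff)
    then have "(\<Sum>\<pi> | \<pi> permutes {..<m}. of_int (sign \<pi>) * ?F K \<pi>) =
        det (mat m m (\<lambda>(i, j). path_sum D x (u ! i) (map (\<lambda>i. S ! pick K i) [0..<m] ! j)))"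
      using assms by (intro lindstroem_gessel_viennot) auto
    also have "mat m m (\<lambda>(i, j). path_sum D x (u ! i) (map (\<lambda>i. S ! pick K i) [0..<m] ! j)) =
        mat m m (\<lambda>(i, j). ?H $$ (i, pick K j))"
      using pick assms(5,7) by (intro eq_matI) (auto simp: H_mat_def)
    finally show ?thesis .
  qed
  have "sum ?g ?S = (\<Sum>K\<in>?T. Pf (submatrix A K K) * (\<Sum>\<pi> | \<pi> permutes {..<m}. of_int (sign \<pi>) * ?F K \<pi>))"
    unfolding sum.reindex_bij_betw[OF bij, symmetric] by (intro sum.cong refl) (simp add: tuple sub)
  also have "\<dots> = (\<Sum>K\<in>?T. Pf (submatrix A K K) * det (mat m m (\<lambda>(i, j). ?H $$ (i, pick K j))))"
    by (intro sum.cong refl) (simp only: lgv)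
  also have "\<dots> = Pf (?H * A * transpose_mat ?H)"
    by (rule Pf_minor_summation[OF assms(10,11) H assms(2), symmetric])
  also have "\<dots> = ?rhs"
    by (rule Pf_block_copfaffian_mat[OF assms(10-12) H assms(2,3), symmetric])
  finally have main: "sum ?g ?S = ?rhs" .
  have "sum ?h ?S = sum ?g ?S" if comp: "D_compatible D u S"
    unfolding sum.reindex_bij_betw[OF bij, symmetric]
  proof (rule sum.cong[OF refl])
    fix K assume K: "K \<in> ?T"
    \<comment> \<open>Compatibility leaves only the identity, of sign 1, in the signed sum, which
      thus reduces to \<open>F0\<close> for the unpermuted \<open>u\<close>.\<close>
    have "(\<Sum>\<pi> | \<pi> permutes {..<m}. of_int (sign \<pi>) * ?F K \<pi>) = (\<Sum>\<pi>\<in>{id}. of_int (sign \<pi>) * ?F K \<pi>)"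
    proof (rule sum.mono_neutral_right)
      show "\<forall>\<pi>\<in>{\<pi>. \<pi> permutes {..<m}} - {id}. of_int (sign \<pi>) * ?F K \<pi> = 0"
        using F0_D_compatible_eq_0[OF comp, of _ m K x] K assms(5,7) by auto
    qed (auto simp: finite_permutations)
    then show "?h ((!) S ` K) = ?g ((!) S ` K)"
      unfolding tuple[OF K] by simp
  qed
  with main show ?thesis by auto
qed

end
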